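(* Let $(\mathcal{X},d)$ be a proper metric space, $N\ge1$, $(\boldsymbol{\lambda},\boldsymbol{\nu})\in\Delta_N\times\mathcal{P}_1(\mathcal{X})^N$, and $(\boldsymbol{\lambda}^n,\boldsymbol{\nu}^n)_{n\in\mathbb{N}}$ a sequence in $\Delta_N\times\mathcal{P}_1(\mathcal{X})^N$ with $\sum_{i=1}^N|\lambda_i^n-\lambda_i|+\max_iW_1(\nu_i^n,\nu_i)\to0$. Let $\mu^n\in\mathrm{Med}_{\boldsymbol{\lambda}^n}(\boldsymbol{\nu}^n)$ for all $n$. Then $(\mu^n)_n$ admits a subsequence converging for $W_1$ to some $\mu\in\mathrm{Med}_{\boldsymbol{\lambda}}(\boldsymbol{\nu})$. In particular $\mathrm{Med}_{\boldsymbol{\lambda}}(\boldsymbol{\nu})$ is compact (for $W_1$) and the set-valued map $(\boldsymbol{\lambda},\boldsymbol{\nu})\in\Delta_N\times\mathcal{P}_1(\mathcal{X})^N\mapsto\mathrm{Med}_{\boldsymbol{\lambda}}(\boldsymbol{\nu})\subset\mathcal{P}_1(\mathcal{X})$ has a closed graph for the $W_1$ distance.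
   Context: A metric space is proper if its closed balls are compact. $\Delta_N$ is the unit simplex of $\mathbb{R}^N$. $\mathcal{P}_1(\mathcal{X})$ is the set of Borel probability measures on $\mathcal{X}$ with finite first moment, equipped with the 1-Wasserstein distance $W_1$. $\mathrm{Med}_{\boldsymbol{\lambda}}(\boldsymbol{\nu})$ is the set of minimizers over $\mu\in\mathcal{P}_1(\mathcal{X})$ of $\sum_{i=1}^N\lambda_iW_1(\nu_i,\mu)$. *)

theory Defs
  imports "HOL-Probability.Probability"
begin

definition proper_space :: "'a::metric_space itself \<Rightarrow> bool" where
  "proper_space _ \<longleftrightarrow> (\<forall>(x::'a) (r::real). compact (cball x r))"

definition unit_simplex :: "nat \<Rightarrow> (nat \<Rightarrow> real) \<Rightarrow> bool" where
  "unit_simplex N lam \<longleftrightarrow> (\<forall>i<N. 0 \<le> lam i) \<and> (\<Sum>i<N. lam i) = 1"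

definition P1 :: "'a::metric_space measure set" where
  "P1 = {\<mu>. prob_space \<mu> \<and> sets \<mu> = sets (borel :: 'a measure) \<and>
              (\<exists>x0. (\<integral>\<^sup>+ y. ennreal (dist x0 y) \<partial>\<mu>) < \<infinity>)}"

definition couplings :: "'a::metric_space measure \<Rightarrow> 'a measure \<Rightarrow> ('a \<times> 'a) measure set" where
  "couplings \<mu> \<nu> = {\<pi>. sets \<pi> = sets (borel :: ('a \<times> 'a) measure) \<and>
                        distr \<pi> borel fst = \<mu> \<and> distr \<pi> borel snd = \<nu>}"

text \<open>1-Wasserstein distance (real-valued; finite on P1).\<close>
definition W1 :: "'a::metric_space measure \<Rightarrow> 'a measure \<Rightarrow> real" where
  "W1 \<mu> \<nu> = enn2real (\<Sqinter>\<pi>\<in>couplings \<mu> \<nu>. \<integral>\<^sup>+ p. ennreal (dist (fst p) (snd p)) \<partial>\<pi>)"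

definition Med :: "nat \<Rightarrow> (nat \<Rightarrow> real) \<Rightarrow> (nat \<Rightarrow> 'a::metric_space measure) \<Rightarrow> 'a measure set" where
  "Med N lam nu = {\<mu> \<in> P1. \<forall>\<mu>'\<in>P1.
      (\<Sum>i<N. lam i * W1 (nu i) \<mu>) \<le> (\<Sum>i<N. lam i * W1 (nu i) \<mu>')}"

end

theory Submission
  imports Defs
begin

text \<open>
  Let \<open>T\<close> send the complement of the ball of radius \<open>4 * K\<close> around \<open>x0\<close> to \<open>x0\<close>. Comparing a median
  \<open>\<mu>\<close> with its image under \<open>T\<close> bounds the first moment of \<open>\<mu>\<close> outside that ball by four times the
  weighted first moments of the \<open>\<nu>\<^sub>i\<close> outside the ball of radius \<open>K\<close>. So medians of a convergent
  sequence of data have uniformly integrable first moments. In a proper space this gives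
  relative compactness for \<open>W1\<close>: an injective Borel coding \<open>X \<rightarrow> \<real>\<close> whose inverse extends
  continuously to the closure of its range reduces the claim to the Helly selection theorem and
  Skorohod's theorem on the line. That the limit is again a median follows from the triangle
  inequality for \<open>W1\<close>, which is obtained by gluing couplings along countable Borel partitions
  of small mesh.
\<close>

section \<open>Gluing of couplings\<close>

text \<open>The glued measure is the independent coupling conditioned on the common value of \<open>c1\<close> and \<open>c2\<close>.\<close>

lemma discrete_gluing:
  assumes "prob_space M1" "prob_space M2"
    and c1 [measurable]: "c1 \<in> measurable M1 (count_space (UNIV :: nat set))"
    and c2 [measurable]: "c2 \<in> measurable M2 (count_space (UNIV :: nat set))"
    and eq: "distr M1 (count_space UNIV) c1 = distr M2 (count_space UNIV) c2"
  obtains P where "sets P = sets (M1 \<Otimes>\<^sub>M M2)" "distr P M1 fst = M1" "distr P M2 snd = M2"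
    "AE p in P. c1 (fst p) = c2 (snd p)"
proof -
  interpret M1: prob_space M1 by fact
  interpret M2: prob_space M2 by fact
  interpret pair_prob_space M1 M2 ..
  define w where "w k = emeasure M1 {p \<in> space M1. c1 p = k}" for k
  have vimage: "c -` {k} \<inter> space M = {p \<in> space M. c p = k}"
    for c :: "'z \<Rightarrow> nat" and M and k
    by auto
  have w2: "w k = emeasure M2 {q \<in> space M2. c2 q = k}" for k
    using arg_cong[OF eq, of "\<lambda>D. emeasure D {k}"]
    by (simp add: emeasure_distr vimage w_def)
  have w_fin: "w k \<noteq> top" for k
    by (simp add: w_def)
  define f where "f p = (if c1 (fst p) = c2 (snd p) then 1 / w (c1 (fst p)) else 0)" for p
  have [measurable]: "(\<lambda>p. w (c1 (fst p))) \<in> borel_measurable (M1 \<Otimes>\<^sub>M M2)"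
    by (rule measurable_compose[where N = "count_space UNIV"]) (auto intro: measurable_compose[OF measurable_fst c1])
  have [measurable]: "f \<in> borel_measurable (M1 \<Otimes>\<^sub>M M2)"
    unfolding f_def
  proof (rule measurable_If)
    show "{p \<in> space (M1 \<Otimes>\<^sub>M M2). c1 (fst p) = c2 (snd p)} \<in> sets (M1 \<Otimes>\<^sub>M M2)"
    proof -
      have "{p \<in> space (M1 \<Otimes>\<^sub>M M2). c1 (fst p) = c2 (snd p)}
          = (\<Union>k. (c1 -` {k} \<inter> space M1) \<times> (c2 -` {k} \<inter> space M2))"
        by (auto simp: space_pair_measure)
      also have "\<dots> \<in> sets (M1 \<Otimes>\<^sub>M M2)"
        by (intro sets.countable_UN' pair_measureI measurable_sets[OF c1] measurable_sets[OF c2]) auto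
      finally show ?thesis .
    qed
  qed measurable
  define P where "P = density (M1 \<Otimes>\<^sub>M M2) f"
  \<comment> \<open>There are only countably many cells, so those with \<open>w k = 0\<close> form a
    null set together. Hence the value 1 / 0 that \<open>f\<close> takes on them does no
    harm.\<close>
  have pos: "AE p in M. w (c p) \<noteq> 0"
    if [measurable]: "c \<in> measurable M (count_space UNIV)"
      and null: "\<And>k. w k = emeasure M {p \<in> space M. c p = k}" for M :: "'z measure" and c
  proof -
    have "AE p in M. \<forall>k. w k = 0 \<longrightarrow> c p \<noteq> k"
      unfolding AE_all_countable
    proof
      fix k
      show "AE p in M. w k = 0 \<longrightarrow> c p \<noteq> k"
      proof (cases "w k = 0")
        case True
        then show ?thesis by (intro AE_I[where N = "{p \<in> space M. c p = k}"]) (auto simp: null)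
      qed simp
    qed
    then show ?thesis by eventually_elim auto
  qed
  \<comment> \<open>The cell of \<open>p\<close> has the same mass \<open>w (c1 p)\<close> under
    \<open>M2\<close>, so integrating out the second variable leaves 1. This and \<open>f2\<close>
    are what preserves the two marginals.\<close>
  have f1: "(\<integral>\<^sup>+q. f (p, q) \<partial>M2) = 1" if "w (c1 p) \<noteq> 0" for p
  proof -
    have "(\<integral>\<^sup>+q. f (p, q) \<partial>M2)
        = (\<integral>\<^sup>+q. indicator {q \<in> space M2. c2 q = c1 p} q / w (c1 p) \<partial>M2)"
      by (intro nn_integral_cong) (auto simp: f_def indicator_def)
    also have "\<dots> = w (c1 p) / w (c1 p)"
      by (subst nn_integral_divide) (auto simp: w2[symmetric])
    finally show ?thesis using that w_fin[of "c1 p"] by (simp add: less_top)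
  qed
  have f2: "(\<integral>\<^sup>+p. f (p, q) \<partial>M1) = 1" if "w (c2 q) \<noteq> 0" for q
  proof -
    have "(\<integral>\<^sup>+p. f (p, q) \<partial>M1)
        = (\<integral>\<^sup>+p. indicator {p \<in> space M1. c1 p = c2 q} p / w (c2 q) \<partial>M1)"
      by (intro nn_integral_cong) (auto simp: f_def indicator_def)
    also have "\<dots> = w (c2 q) / w (c2 q)"
      by (subst nn_integral_divide) (auto simp: w_def[symmetric])
    finally show ?thesis using that w_fin[of "c2 q"] by (simp add: less_top)
  qed
  have "distr P M1 fst = M1"
  proof (rule measure_eqI)
    fix A assume "A \<in> sets (distr P M1 fst)"
    then have [measurable]: "A \<in> sets M1" by simp
    have "emeasure (distr P M1 fst) A = (\<integral>\<^sup>+x. indicator A x \<partial>distr P M1 fst)"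
      by simp
    also have "\<dots> = (\<integral>\<^sup>+x. indicator A (fst x) \<partial>P)"
      by (subst nn_integral_distr) (auto simp: P_def)
    also have "\<dots> = (\<integral>\<^sup>+x. f x * indicator A (fst x) \<partial>(M1 \<Otimes>\<^sub>M M2))"
      unfolding P_def by (subst nn_integral_density) auto
    also have "\<dots> = (\<integral>\<^sup>+p. (\<integral>\<^sup>+q. f (p, q) * indicator A p \<partial>M2) \<partial>M1)"
      by (subst M2.nn_integral_fst[symmetric]) auto
    also have "\<dots> = (\<integral>\<^sup>+p. indicator A p \<partial>M1)"
      by (rule nn_integral_cong_AE, rule AE_mp[OF pos[OF c1 w_def]])
        (auto simp: nn_integral_multc f1)
    finally show "emeasure (distr P M1 fst) A = emeasure M1 A" by simp
  qed simp
  moreover have "distr P M2 snd = M2"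
  proof (rule measure_eqI)
    fix A assume "A \<in> sets (distr P M2 snd)"
    then have [measurable]: "A \<in> sets M2" by simp
    have "emeasure (distr P M2 snd) A = (\<integral>\<^sup>+x. indicator A x \<partial>distr P M2 snd)"
      by simp
    also have "\<dots> = (\<integral>\<^sup>+x. indicator A (snd x) \<partial>P)"
      by (subst nn_integral_distr) (auto simp: P_def)
    also have "\<dots> = (\<integral>\<^sup>+x. f x * indicator A (snd x) \<partial>(M1 \<Otimes>\<^sub>M M2))"
      unfolding P_def by (subst nn_integral_density) auto
    also have "\<dots> = (\<integral>\<^sup>+q. (\<integral>\<^sup>+p. f (p, q) * indicator A q \<partial>M1) \<partial>M2)"
      by (subst nn_integral_snd[symmetric]) auto
    also have "\<dots> = (\<integral>\<^sup>+q. indicator A q \<partial>M2)"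
      by (rule nn_integral_cong_AE, rule AE_mp[OF pos[OF c2 w2]])
        (auto simp: nn_integral_multc f2)
    finally show "emeasure (distr P M2 snd) A = emeasure M2 A" by simp
  qed simp
  moreover have "AE p in P. c1 (fst p) = c2 (snd p)"
    unfolding P_def by (subst AE_density) (auto simp: f_def indicator_def split: if_splits)
  moreover have "sets P = sets (M1 \<Otimes>\<^sub>M M2)"
    by (simp add: P_def)
  ultimately show ?thesis using that by blast
qed

section \<open>Separable metric spaces and measurability of pairs\<close>

locale separable_metric =
  fixes d :: "nat \<Rightarrow> 'a::metric_space"
  assumes dense: "0 < e \<Longrightarrow> \<exists>k. dist (d k) x < e"
begin

text \<open>By separability an open subset of the square is a countable union of products of balls
  with centres \<open>d i\<close> and radii 1 / (n + 1). Couplings live on \<open>borel\<close> of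
  the product, and this makes pairs of random variables measurable into it.\<close>

lemma measurable_Pair_borel [measurable (raw)]:
  fixes f g :: "'b \<Rightarrow> 'a"
  assumes [measurable]: "f \<in> borel_measurable M" "g \<in> borel_measurable M"
  shows "(\<lambda>x. (f x, g x)) \<in> borel_measurable M"
proof (rule borel_measurableI)
  fix S :: "('a \<times> 'a) set" assume "open S"
  define B where "B i n = ball (d i) (1 / real (Suc n))" for i n
  have [measurable]: "B i n \<in> sets borel" for i n
    by (simp add: B_def)
  define I where "I = {(i, j, n). B i n \<times> B j n \<subseteq> S}"
  have "p \<in> (\<Union>(i, j, n)\<in>I. B i n \<times> B j n)" if p: "p \<in> S" for p
  proof -
    obtain x y where xy: "p = (x, y)" by fastforce
    obtain e where e: "0 < e" "ball p e \<subseteq> S"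
      using \<open>open S\<close> p open_contains_ball by blast
    \<comment> \<open>With radius below e / 4, points of one ball are less than e / 2 apart. The
      product distance is at most the sum of the two coordinate distances, hence below e.\<close>
    obtain n where n: "1 / real (Suc n) < e / 4"
      using e(1) nat_approx_posE[of "e / 4"] by auto
    obtain i j where ij: "dist (d i) x < 1 / real (Suc n)" "dist (d j) y < 1 / real (Suc n)"
      using dense[of "1 / real (Suc n)"] by fastforce
    have "(x', y') \<in> S" if "x' \<in> B i n" "y' \<in> B j n" for x' y'
    proof -
      have "dist x x' < e / 2"
        using that(1) ij(1) n dist_triangle3[of x x' "d i"] by (simp add: B_def)
      moreover have "dist y y' < e / 2"
        using that(2) ij(2) n dist_triangle3[of y y' "d j"] by (simp add: B_def)
      ultimately have "dist (x, y) (x', y') < e"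
        using sqrt_sum_squares_le_sum[of "dist x x'" "dist y y'"] by (simp add: dist_Pair_Pair)
      then show ?thesis using e(2) by (auto simp: xy)
    qed
    then have "(i, j, n) \<in> I" by (auto simp: I_def)
    moreover have "p \<in> B i n \<times> B j n" using ij by (simp add: xy B_def)
    ultimately show ?thesis by blast
  qed
  then have S: "S = (\<Union>(i, j, n)\<in>I. B i n \<times> B j n)"
    by (auto simp: I_def)
  have "(\<lambda>x. (f x, g x)) -` S \<inter> space M
      = (\<Union>(i, j, n)\<in>I. {x \<in> space M. f x \<in> B i n \<and> g x \<in> B j n})"
    unfolding S by blast
  also have "\<dots> \<in> sets M"
    by (intro sets.countable_UN') (auto split: prod.split)
  finally show "(\<lambda>x. (f x, g x)) -` S \<inter> space M \<in> sets M" .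
qed

end

section \<open>The Wasserstein distance\<close>

text \<open>Since \<open>enn2real\<close> sends infinity to 0, inequalities are first proved for
  this extended value and then transferred to \<open>W1\<close> on \<open>P1\<close>, where it is
  finite.\<close>

definition ennW1 :: "'a::metric_space measure \<Rightarrow> 'a measure \<Rightarrow> ennreal" where
  "ennW1 \<mu> \<nu> = (\<Sqinter>\<pi>\<in>couplings \<mu> \<nu>. \<integral>\<^sup>+ p. ennreal (dist (fst p) (snd p)) \<partial>\<pi>)"

lemma W1_eq: "W1 \<mu> \<nu> = enn2real (ennW1 \<mu> \<nu>)"
  by (simp add: W1_def ennW1_def)

lemma W1_nonneg: "0 \<le> W1 \<mu> \<nu>"
  by (simp add: W1_eq)

lemma P1D: "\<mu> \<in> P1 \<Longrightarrow> prob_space \<mu>" "\<mu> \<in> P1 \<Longrightarrow> sets \<mu> = sets borel"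
  by (simp_all add: P1_def)

lemma measurable_fst_borel: "fst \<in> measurable borel borel"
  and measurable_snd_borel: "snd \<in> measurable borel borel"
  by (auto intro!: borel_measurable_continuous_onI continuous_intros)

lemma coupling_lessE:
  assumes "ennW1 \<mu> \<nu> < c"
  obtains \<pi> where "sets \<pi> = sets borel" "distr \<pi> borel fst = \<mu>" "distr \<pi> borel snd = \<nu>"
    "(\<integral>\<^sup>+ p. ennreal (dist (fst p) (snd p)) \<partial>\<pi>) < c"
  using assms unfolding ennW1_def INF_less_iff by (auto simp: couplings_def)

lemma measurable_borel_sets_eq:
  "sets \<pi> = sets borel \<Longrightarrow> f \<in> borel_measurable borel \<Longrightarrow> f \<in> borel_measurable \<pi>"
  by (subst measurable_cong_sets) auto

context separable_metric
begin

lemma measurable_dist_borel [measurable (raw)]: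
  assumes [measurable]: "f \<in> borel_measurable M" "g \<in> borel_measurable M"
  shows "(\<lambda>x. dist (f x) (g x :: 'a)) \<in> borel_measurable M"
proof -
  have "(\<lambda>p. dist (fst p) (snd p :: 'a)) \<in> borel_measurable borel"
    by (intro borel_measurable_continuous_onI continuous_intros)
  from measurable_compose[OF measurable_Pair_borel[OF assms] this] show ?thesis
    by simp
qed

text \<open>Two random variables with the prescribed laws on a common space yield a coupling by
  pushing forward under their pair. Upper bounds on the distance can thus be computed on any
  convenient space.\<close>

lemma ennW1_le:
  assumes [measurable]: "X \<in> borel_measurable M" "Y \<in> borel_measurable M"
    and "distr M borel X = \<mu>" "distr M borel Y = (\<nu> :: 'a measure)"
  shows "ennW1 \<mu> \<nu> \<le> (\<integral>\<^sup>+ x. ennreal (dist (X x) (Y x)) \<partial>M)"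
proof -
  note [measurable] = measurable_fst_borel measurable_snd_borel
  have "distr M borel (\<lambda>x. (X x, Y x)) \<in> couplings \<mu> \<nu>"
    using assms by (auto simp: couplings_def distr_distr comp_def)
  moreover have "(\<integral>\<^sup>+ p. ennreal (dist (fst p) (snd p)) \<partial>distr M borel (\<lambda>x. (X x, Y x)))
      = (\<integral>\<^sup>+ x. ennreal (dist (X x) (Y x)) \<partial>M)"
    by (subst nn_integral_distr) auto
  ultimately show ?thesis
    unfolding ennW1_def by (auto intro: INF_lower2)
qed

lemma ennW1_refl: "sets \<mu> = sets borel \<Longrightarrow> ennW1 \<mu> (\<mu> :: 'a measure) = 0"
  using ennW1_le[of "\<lambda>x. x" \<mu> "\<lambda>x. x" \<mu> \<mu>]
  by (simp add: measurable_borel_sets_eq distr_id2)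

lemma ennW1_commute: "ennW1 \<mu> \<nu> = ennW1 \<nu> (\<mu> :: 'a measure)"
proof -
  have "ennW1 \<mu> \<nu> \<le> ennW1 \<nu> \<mu>" for \<mu> \<nu> :: "'a measure"
    unfolding ennW1_def[of \<nu> \<mu>]
  proof (rule INF_greatest)
    fix \<pi> :: "('a \<times> 'a) measure" assume "\<pi> \<in> couplings \<nu> \<mu>"
    then show "ennW1 \<mu> \<nu> \<le> (\<integral>\<^sup>+ p. ennreal (dist (fst p) (snd p)) \<partial>\<pi>)"
      using ennW1_le[of snd \<pi> fst \<mu> \<nu>]
      by (simp add: couplings_def measurable_borel_sets_eq measurable_fst_borel
          measurable_snd_borel dist_commute)
  qed
  then show ?thesis by (intro antisym)
qed

text \<open>A point is labelled by the first dense point within e / 2 of it, so two points with the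
  same label are both close to the same centre.\<close>

lemma countable_Borel_cells:
  assumes "0 < e"
  obtains c where "c \<in> measurable borel (count_space UNIV)"
    "\<And>x y :: 'a. (c x :: nat) = c y \<Longrightarrow> dist x y < e"
proof
  let ?c = "\<lambda>x. LEAST k. dist (d k) x < e / 2"
  show "?c \<in> measurable borel (count_space UNIV)"
    by measurable
  fix x y assume eq: "?c x = ?c y"
  have near: "dist (d (?c z)) z < e / 2" for z
    using dense[of "e / 2" z] assms by (auto intro: LeastI_ex)
  show "dist x y < e"
    using near[of x] near[of y] dist_triangle3[of x y "d (?c x)"] eq by simp
qed

text \<open>Two almost optimal couplings are glued along a partition of mesh e / 3 instead of along
  \<rho> itself. The two copies of the middle point then share a cell without being equal, which
  costs a third e / 3 besides the two losses of optimality; \<open>e\<close> is arbitrary.\<close>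

lemma ennW1_triangle:
  assumes "prob_space \<rho>" and sets_\<rho>: "sets \<rho> = sets borel"
  shows "ennW1 \<mu> \<nu> \<le> ennW1 \<mu> \<rho> + ennW1 \<rho> (\<nu> :: 'a measure)"
proof (rule ennreal_le_epsilon)
  fix e :: real assume fin: "ennW1 \<mu> \<rho> + ennW1 \<rho> \<nu> < top" and e: "0 < e"
  let ?C = "\<lambda>p. ennreal (dist (fst p) (snd p))"
  have "ennW1 \<mu> \<rho> < ennW1 \<mu> \<rho> + e / 3" "ennW1 \<rho> \<nu> < ennW1 \<rho> \<nu> + e / 3"
    using fin e by (simp_all add: ennreal_add_left_cancel_less[where b = 0, simplified] less_top)
  note less = this
  obtain \<pi>1 where \<pi>1: "sets \<pi>1 = sets borel" "distr \<pi>1 borel fst = \<mu>" "distr \<pi>1 borel snd = \<rho>"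
        "(\<integral>\<^sup>+ p. ?C p \<partial>\<pi>1) < ennW1 \<mu> \<rho> + e / 3"
    by (rule coupling_lessE[OF less(1)])
  obtain \<pi>2 where \<pi>2: "sets \<pi>2 = sets borel" "distr \<pi>2 borel fst = \<rho>" "distr \<pi>2 borel snd = \<nu>"
        "(\<integral>\<^sup>+ p. ?C p \<partial>\<pi>2) < ennW1 \<rho> \<nu> + e / 3"
    by (rule coupling_lessE[OF less(2)])
  note m [measurable] = measurable_borel_sets_eq[OF \<pi>1(1) measurable_fst_borel]
    measurable_borel_sets_eq[OF \<pi>1(1) measurable_snd_borel]
    measurable_borel_sets_eq[OF \<pi>2(1) measurable_fst_borel]
    measurable_borel_sets_eq[OF \<pi>2(1) measurable_snd_borel]
  obtain c where c [measurable]: "c \<in> measurable borel (count_space (UNIV :: nat set))"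
    and near: "\<And>x y :: 'a. c x = c y \<Longrightarrow> dist x y < e / 3"
    using countable_Borel_cells[of "e / 3"] e by (metis divide_pos_pos zero_less_numeral)
  have prob: "prob_space \<pi>1" "prob_space \<pi>2"
    using prob_space_distrD[OF m(2)] prob_space_distrD[OF m(3)] assms(1) \<pi>1 \<pi>2 by auto
  have "distr \<pi>1 (count_space UNIV) (\<lambda>p. c (snd p)) = distr (distr \<pi>1 borel snd) (count_space UNIV) c"
    "distr \<pi>2 (count_space UNIV) (\<lambda>p. c (fst p)) = distr (distr \<pi>2 borel fst) (count_space UNIV) c"
    by (simp_all add: distr_distr comp_def)
  then have "distr \<pi>1 (count_space UNIV) (\<lambda>p. c (snd p)) = distr \<pi>2 (count_space UNIV) (\<lambda>p. c (fst p))"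
    by (simp add: \<pi>1 \<pi>2)
  then obtain P where P: "sets P = sets (\<pi>1 \<Otimes>\<^sub>M \<pi>2)" "distr P \<pi>1 fst = \<pi>1" "distr P \<pi>2 snd = \<pi>2"
    and cells: "AE p in P. c (snd (fst p)) = c (fst (snd p))"
    using discrete_gluing[OF prob, of "\<lambda>p. c (snd p)" "\<lambda>p. c (fst p)"] by auto
  have [measurable]: "fst \<in> measurable P \<pi>1" "snd \<in> measurable P \<pi>2"
    by (simp_all add: measurable_cong_sets[OF P(1) refl])
  have "prob_space P"
    using prob_space_distrD[of fst P \<pi>1] prob P by simp
  then interpret P: prob_space P .
  have "ennW1 \<mu> \<nu> \<le> (\<integral>\<^sup>+ p. ennreal (dist (fst (fst p)) (snd (snd p))) \<partial>P)"
  proof (rule ennW1_le)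
    have "distr P borel (\<lambda>p. fst (fst p)) = distr (distr P \<pi>1 fst) borel fst"
      by (simp add: distr_distr comp_def)
    then show "distr P borel (\<lambda>p. fst (fst p)) = \<mu>" by (simp add: P \<pi>1)
    have "distr P borel (\<lambda>p. snd (snd p)) = distr (distr P \<pi>2 snd) borel snd"
      by (simp add: distr_distr comp_def)
    then show "distr P borel (\<lambda>p. snd (snd p)) = \<nu>" by (simp add: P \<pi>2)
  qed measurable
  also have "\<dots> \<le> (\<integral>\<^sup>+ p. ?C (fst p) + ?C (snd p) + ennreal (e / 3) \<partial>P)"
  proof (rule nn_integral_mono_AE, use cells in eventually_elim)
    case (elim p)
    have "dist (fst (fst p)) (snd (snd p))
        \<le> dist (fst (fst p)) (snd (fst p)) + dist (fst (snd p)) (snd (snd p)) + e / 3"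
      using near[OF elim] dist_triangle[of "fst (fst p)" "snd (snd p)" "snd (fst p)"]
        dist_triangle[of "snd (fst p)" "snd (snd p)" "fst (snd p)"] by linarith
    then show ?case
      using e by (simp add: ennreal_plus[symmetric] del: ennreal_plus)
  qed
  also have "\<dots> = (\<integral>\<^sup>+ p. ?C (fst p) \<partial>P) + (\<integral>\<^sup>+ p. ?C (snd p) \<partial>P) + e / 3"
    by (simp add: nn_integral_add P.emeasure_space_1)
  also have "(\<integral>\<^sup>+ p. ?C (fst p) \<partial>P) = (\<integral>\<^sup>+ p. ?C p \<partial>\<pi>1)"
    using nn_integral_distr[of fst P \<pi>1 ?C] by (simp add: P)
  also have "(\<integral>\<^sup>+ p. ?C (snd p) \<partial>P) = (\<integral>\<^sup>+ p. ?C p \<partial>\<pi>2)"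
    using nn_integral_distr[of snd P \<pi>2 ?C] by (simp add: P)
  also have "(\<integral>\<^sup>+ p. ?C p \<partial>\<pi>1) + (\<integral>\<^sup>+ p. ?C p \<partial>\<pi>2) + e / 3
      \<le> (ennW1 \<mu> \<rho> + e / 3) + (ennW1 \<rho> \<nu> + e / 3) + e / 3"
    using \<pi>1(4) \<pi>2(4) by (intro add_mono) auto
  also have "\<dots> = (ennW1 \<mu> \<rho> + ennW1 \<rho> \<nu>) + (ennreal (e / 3) + ennreal (e / 3) + ennreal (e / 3))"
    by (simp add: ac_simps)
  also have "ennreal (e / 3) + ennreal (e / 3) + ennreal (e / 3) = ennreal e"
    using e by (simp add: ennreal_plus[symmetric] del: ennreal_plus)
  finally show "ennW1 \<mu> \<nu> \<le> ennW1 \<mu> \<rho> + ennW1 \<rho> \<nu> + e" .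
qed

text \<open>The triangle inequality moves the base point at the cost of a constant, which has finite
  integral because \<mu> has mass 1.\<close>

lemma P1_moment:
  assumes "\<mu> \<in> P1"
  shows "(\<integral>\<^sup>+ y. ennreal (dist (x :: 'a) y) \<partial>\<mu>) < \<infinity>"
proof -
  obtain x0 where x0: "(\<integral>\<^sup>+ y. ennreal (dist x0 y) \<partial>\<mu>) < \<infinity>"
    using assms by (auto simp: P1_def)
  interpret prob_space \<mu> using assms by (simp add: P1D)
  have [measurable]: "(\<lambda>x. x) \<in> borel_measurable \<mu>"
    using assms by (simp add: P1D measurable_borel_sets_eq)
  have "(\<integral>\<^sup>+ y. ennreal (dist x y) \<partial>\<mu>) \<le> (\<integral>\<^sup>+ y. ennreal (dist x x0) + ennreal (dist x0 y) \<partial>\<mu>)"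
    by (intro nn_integral_mono) (simp add: dist_triangle ennreal_plus[symmetric] del: ennreal_plus)
  also have "\<dots> = ennreal (dist x x0) + (\<integral>\<^sup>+ y. ennreal (dist x0 y) \<partial>\<mu>)"
    by (simp add: nn_integral_add emeasure_space_1)
  finally show ?thesis using x0 by (simp add: le_less_trans)
qed

text \<open>The detour through a Dirac mass reduces finiteness to that of first moments, because
  transport to a single point costs the first moment about it.\<close>

lemma ennW1_finite:
  assumes "\<mu> \<in> P1" "\<nu> \<in> (P1 :: 'a measure set)"
  shows "ennW1 \<mu> \<nu> < \<infinity>"
proof -
  define x :: 'a where "x = undefined"
  have dirac: "ennW1 \<mu> (return borel x) < \<infinity>" if "\<mu> \<in> P1" for \<mu>
  proof -
    interpret prob_space \<mu> using that by (simp add: P1D)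
    have [measurable]: "(\<lambda>x. x) \<in> borel_measurable \<mu>"
      using that by (simp add: P1D measurable_borel_sets_eq)
    have "ennW1 \<mu> (return borel x) \<le> (\<integral>\<^sup>+ y. ennreal (dist y x) \<partial>\<mu>)"
      using that by (intro ennW1_le) (auto simp: distr_const distr_id2 P1D)
    then show ?thesis
      using P1_moment[OF that, of x] by (simp add: dist_commute le_less_trans)
  qed
  have "ennW1 \<mu> \<nu> \<le> ennW1 \<mu> (return borel x) + ennW1 (return borel x) \<nu>"
    by (intro ennW1_triangle prob_space_return) auto
  also have "\<dots> < \<infinity>"
    using dirac[OF assms(1)] dirac[OF assms(2)] by (simp add: ennW1_commute[of "return borel x"])
  finally show ?thesis .
qed

lemma ennreal_W1: "\<mu> \<in> P1 \<Longrightarrow> \<nu> \<in> P1 \<Longrightarrow> ennreal (W1 \<mu> (\<nu> :: 'a measure)) = ennW1 \<mu> \<nu>"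
  using ennW1_finite by (simp add: W1_eq)

lemma W1_commute: "W1 \<mu> \<nu> = W1 \<nu> (\<mu> :: 'a measure)"
  by (simp add: W1_eq ennW1_commute)

lemma W1_refl: "\<mu> \<in> P1 \<Longrightarrow> W1 \<mu> (\<mu> :: 'a measure) = 0"
  by (simp add: W1_eq ennW1_refl P1D)

lemma W1_triangle:
  assumes "\<mu> \<in> P1" "\<rho> \<in> P1" "\<nu> \<in> (P1 :: 'a measure set)"
  shows "W1 \<mu> \<nu> \<le> W1 \<mu> \<rho> + W1 \<rho> \<nu>"
proof -
  have "ennreal (W1 \<mu> \<nu>) \<le> ennreal (W1 \<mu> \<rho> + W1 \<rho> \<nu>)"
    using ennW1_triangle[of \<rho> \<mu> \<nu>] assms by (simp add: ennreal_W1 W1_nonneg P1D)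
  then show ?thesis by (subst (asm) ennreal_le_iff) (simp_all add: W1_nonneg)
qed

lemma W1_tendsto:
  assumes "\<And>n. \<mu>s n \<in> P1" "\<And>n. \<nu>s n \<in> P1" "\<mu> \<in> P1" "\<nu> \<in> (P1 :: 'a measure set)"
    and "(\<lambda>n. W1 (\<mu>s n) \<mu>) \<longlonglongrightarrow> 0" "(\<lambda>n. W1 (\<nu>s n) \<nu>) \<longlonglongrightarrow> 0"
  shows "(\<lambda>n. W1 (\<mu>s n) (\<nu>s n)) \<longlonglongrightarrow> W1 \<mu> \<nu>"
proof (rule LIM_zero_cancel, rule Lim_null_comparison)
  have "\<bar>W1 (\<mu>s n) (\<nu>s n) - W1 \<mu> \<nu>\<bar> \<le> W1 (\<mu>s n) \<mu> + W1 (\<nu>s n) \<nu>" for n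
    using W1_triangle[OF assms(1)[of n] assms(3) assms(2)[of n]] W1_triangle[OF assms(3,4) assms(2)[of n]]
      W1_triangle[OF assms(3) assms(1)[of n] assms(4)] W1_triangle[OF assms(1)[of n] assms(2)[of n] assms(4)]
      W1_commute[of \<mu> "\<mu>s n"] W1_commute[of \<nu> "\<nu>s n"] by linarith
  then show "\<forall>\<^sub>F n in sequentially.
      norm (W1 (\<mu>s n) (\<nu>s n) - W1 \<mu> \<nu>) \<le> W1 (\<mu>s n) \<mu> + W1 (\<nu>s n) \<nu>"
    by simp
  show "(\<lambda>n. W1 (\<mu>s n) \<mu> + W1 (\<nu>s n) \<nu>) \<longlonglongrightarrow> 0"
    using tendsto_add[OF assms(5,6)] by simp
qed

end

section \<open>First moments outside balls\<close>

text \<open>Making this small uniformly over a family by the choice of \<open>K\<close> is uniform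
  integrability of the distance to \<open>x0\<close>. The strict inequality makes the integrand
  lower semicontinuous, as the use of Fatou's lemma below requires.\<close>

definition tail :: "'a::metric_space \<Rightarrow> real \<Rightarrow> 'a measure \<Rightarrow> real" where
  "tail x0 K \<mu> = enn2real (\<integral>\<^sup>+ y. ennreal (if K < dist x0 y then dist x0 y else 0) \<partial>\<mu>)"

lemma tail_nonneg: "0 \<le> tail x0 K \<mu>"
  by (simp add: tail_def)

lemma ennreal_le_addI:
  "0 \<le> b \<Longrightarrow> 0 \<le> c \<Longrightarrow> a \<le> b + c \<Longrightarrow> ennreal a \<le> ennreal b + ennreal c"
  by (simp add: ennreal_leI flip: ennreal_plus)

lemma ennreal_add_le_addI:
  assumes "0 \<le> a" "0 \<le> b" "0 \<le> c" "0 \<le> d" "a + b \<le> c + d"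
  shows "ennreal a + ennreal b \<le> ennreal c + ennreal d"
  using assms by (simp add: ennreal_leI flip: ennreal_plus)

context separable_metric
begin

text \<open>A lower bound on an infimum is tested on each coupling. The hypothesis keeps
  \<open>b\<close> on the right because subtraction in \<open>ennreal\<close> truncates; a negative
  \<open>a - b\<close> is covered by nonnegativity of \<open>W1\<close>.\<close>

lemma W1_ge_by_couplings:
  assumes P1: "\<mu> \<in> P1" "\<nu> \<in> (P1 :: 'a measure set)" and b: "0 \<le> b"
    and le: "\<And>\<pi>. sets \<pi> = sets borel \<Longrightarrow> distr \<pi> borel fst = \<mu> \<Longrightarrow> distr \<pi> borel snd = \<nu>
      \<Longrightarrow> ennreal a \<le> (\<integral>\<^sup>+ p. ennreal (dist (fst p) (snd p)) \<partial>\<pi>) + ennreal b"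
  shows "a \<le> W1 \<mu> \<nu> + b"
proof -
  have "ennreal (a - b) \<le> ennW1 \<mu> \<nu>"
    unfolding ennW1_def
  proof (rule INF_greatest)
    fix \<pi> assume "\<pi> \<in> couplings \<mu> \<nu>"
    then have "ennreal a \<le> ennreal b + (\<integral>\<^sup>+ p. ennreal (dist (fst p) (snd p)) \<partial>\<pi>)"
      using le[of \<pi>] by (simp add: couplings_def add.commute)
    then show "ennreal (a - b) \<le> (\<integral>\<^sup>+ p. ennreal (dist (fst p) (snd p)) \<partial>\<pi>)"
      using b by (simp add: ennreal_minus[symmetric] ennreal_minus_le_iff)
  qed
  then have "ennreal (a - b) \<le> ennreal (W1 \<mu> \<nu>)"
    by (simp add: ennreal_W1 P1)
  then show ?thesis
    using W1_nonneg[of \<mu> \<nu>] by (simp add: ennreal_le_iff)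
qed

lemma ennreal_tail:
  assumes "\<mu> \<in> P1"
  shows "ennreal (tail (x0 :: 'a) K \<mu>)
    = (\<integral>\<^sup>+ y. ennreal (if K < dist x0 y then dist x0 y else 0) \<partial>\<mu>)"
proof -
  have "(\<integral>\<^sup>+ y. ennreal (if K < dist x0 y then dist x0 y else 0) \<partial>\<mu>)
      \<le> (\<integral>\<^sup>+ y. ennreal (dist x0 y) \<partial>\<mu>)"
    by (intro nn_integral_mono) simp
  then show ?thesis
    using P1_moment[OF assms, of x0] by (simp add: tail_def le_less_trans)
qed

lemma tail_antimono:
  assumes "\<mu> \<in> P1" "K \<le> L"
  shows "tail (x0 :: 'a) L \<mu> \<le> tail x0 K \<mu>"
proof -
  have "ennreal (tail x0 L \<mu>) \<le> ennreal (tail x0 K \<mu>)"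
    unfolding ennreal_tail[OF assms(1)] using assms(2) by (intro nn_integral_mono) auto
  then show ?thesis by (simp add: tail_nonneg ennreal_le_iff)
qed

lemma tail_tendsto_0:
  assumes "\<mu> \<in> P1"
  shows "(\<lambda>n. tail (x0 :: 'a) (real n) \<mu>) \<longlonglongrightarrow> 0"
proof -
  have [measurable]: "(\<lambda>x. x) \<in> borel_measurable \<mu>"
    using assms by (simp add: P1D measurable_borel_sets_eq)
  have "(\<lambda>n. \<integral>\<^sup>+ y. ennreal (if real n < dist x0 y then dist x0 y else 0) \<partial>\<mu>) \<longlonglongrightarrow> (\<integral>\<^sup>+ y. 0 \<partial>\<mu>)"
  proof (rule nn_integral_dominated_convergence)
    show "AE y in \<mu>. (\<lambda>n. ennreal (if real n < dist x0 y then dist x0 y else 0)) \<longlonglongrightarrow> 0"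
    proof (rule AE_I2)
      fix y
      obtain m where m: "dist x0 y \<le> real m" using real_arch_simple by blast
      have "\<forall>\<^sub>F n in sequentially. ennreal (if real n < dist x0 y then dist x0 y else 0) = 0"
        using eventually_ge_at_top[of m]
      proof eventually_elim
        case (elim n)
        then have "real m \<le> real n" by simp
        with m show ?case by simp
      qed
      then show "(\<lambda>n. ennreal (if real n < dist x0 y then dist x0 y else 0)) \<longlonglongrightarrow> 0"
        by (rule tendsto_eventually)
    qed
  qed (use P1_moment[OF assms, of x0] in auto)
  then have "(\<lambda>n. ennreal (tail x0 (real n) \<mu>)) \<longlonglongrightarrow> ennreal 0"
    by (simp add: ennreal_tail[OF assms])
  then show ?thesis
    by (subst (asm) tendsto_ennreal_iff) (auto simp: tail_nonneg)
qed

lemma tail_small: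
  assumes "\<mu> \<in> P1" "0 < e"
  obtains K where "0 \<le> K" "\<And>L. K \<le> L \<Longrightarrow> tail (x0 :: 'a) L \<mu> < e"
proof -
  obtain n where "tail x0 (real n) \<mu> < e"
    using order_tendstoD(2)[OF tail_tendsto_0[OF assms(1)] assms(2)]
    by (auto simp: eventually_sequentially)
  then show ?thesis
    using that[of "real n"] tail_antimono[OF assms(1)] by (meson le_less_trans of_nat_0_le_iff)
qed

lemma nn_integral_tail_distr:
  assumes f [measurable]: "f \<in> borel_measurable M" and \<mu>: "distr M borel f = \<mu>" "\<mu> \<in> P1"
    and "0 \<le> c"
  shows "(\<integral>\<^sup>+ p. ennreal (c * (if K < dist x0 (f p) then dist x0 (f p) else 0)) \<partial>M)
    = ennreal (c * tail (x0 :: 'a) K \<mu>)"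
proof -
  have "(\<integral>\<^sup>+ p. ennreal (if K < dist x0 (f p) then dist x0 (f p) else 0) \<partial>M)
      = ennreal (tail x0 K \<mu>)"
    unfolding ennreal_tail[OF \<mu>(2)] unfolding \<mu>(1)[symmetric]
    by (subst nn_integral_distr) auto
  then show ?thesis
    unfolding ennreal_mult'[OF \<open>0 \<le> c\<close>] by (subst nn_integral_cmult) auto
qed

text \<open>Let a coupling match x with a point y beyond radius 2K. If x is within K, the transport
  distance is at least half of the distance from \<open>x0\<close> to y. Otherwise the triangle
  inequality bounds that distance by the transport distance plus the distance from \<open>x0\<close>
  to x. So uniform integrability passes to measures near \<nu>.\<close>

lemma tail_le_W1_tail:
  assumes P1: "\<nu> \<in> P1" "\<nu>' \<in> P1" and K: "0 \<le> K"
  shows "tail (x0 :: 'a) (2 * K) \<nu>' \<le> 2 * W1 \<nu> \<nu>' + 2 * tail x0 K \<nu>"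
proof -
  let ?h = "\<lambda>K y. if K < dist x0 y then dist x0 y else 0"
  have "1 / 2 * tail x0 (2 * K) \<nu>' \<le> W1 \<nu> \<nu>' + tail x0 K \<nu>"
  proof (rule W1_ge_by_couplings[OF P1 tail_nonneg])
    fix \<pi> :: "('a \<times> 'a) measure"
    assume \<pi>: "sets \<pi> = sets borel" "distr \<pi> borel fst = \<nu>" "distr \<pi> borel snd = \<nu>'"
    note m [measurable] = measurable_borel_sets_eq[OF \<pi>(1) measurable_fst_borel]
      measurable_borel_sets_eq[OF \<pi>(1) measurable_snd_borel]
    have "ennreal (1 / 2 * tail x0 (2 * K) \<nu>') = (\<integral>\<^sup>+ p. ennreal (1 / 2 * ?h (2 * K) (snd p)) \<partial>\<pi>)"
      by (subst nn_integral_tail_distr[OF m(2) \<pi>(3) P1(2)]) auto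
    also have "\<dots> \<le> (\<integral>\<^sup>+ p. ennreal (dist (fst p) (snd p)) + ennreal (?h K (fst p)) \<partial>\<pi>)"
    proof (rule nn_integral_mono)
      fix p
      have "1 / 2 * ?h (2 * K) (snd p) \<le> dist (fst p) (snd p) + ?h K (fst p)"
        using dist_triangle[of x0 "snd p" "fst p"] K by auto
      then show "ennreal (1 / 2 * ?h (2 * K) (snd p))
          \<le> ennreal (dist (fst p) (snd p)) + ennreal (?h K (fst p))"
        by (intro ennreal_le_addI) auto
    qed
    also have "\<dots> = (\<integral>\<^sup>+ p. ennreal (dist (fst p) (snd p)) \<partial>\<pi>) + ennreal (tail x0 K \<nu>)"
      using nn_integral_tail_distr[OF m(1) \<pi>(2) P1(1), of 1 K x0] by (subst nn_integral_add) auto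
    finally show "ennreal (1 / 2 * tail x0 (2 * K) \<nu>')
        \<le> (\<integral>\<^sup>+ p. ennreal (dist (fst p) (snd p)) \<partial>\<pi>) + ennreal (tail x0 K \<nu>)" .
  qed
  then show ?thesis by simp
qed

text \<open>Replacing \<mu> by its image under \<open>T\<close> cannot lower the weighted cost. For
  each \<open>nu i\<close> it saves half of the tail of \<mu> beyond 4K, up to twice the tail of
  \<open>nu i\<close> beyond K; averaging with the weights leaves only the tails.\<close>

lemma Med_tail:
  assumes lam: "unit_simplex N lam" and nu: "\<And>i. i < N \<Longrightarrow> nu i \<in> P1"
    and \<mu>: "\<mu> \<in> Med N lam nu" and K: "0 \<le> K"
  shows "tail (x0 :: 'a) (4 * K) \<mu> \<le> 4 * (\<Sum>i<N. lam i * tail x0 K (nu i))"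
proof -
  have \<mu>P1: "\<mu> \<in> P1" using \<mu> by (simp add: Med_def)
  interpret prob_space \<mu> using \<mu>P1 by (simp add: P1D)
  define T where "T y = (if 4 * K < dist x0 y then x0 else y)" for y
  have [measurable]: "T \<in> borel_measurable borel"
    unfolding T_def by measurable
  have T_\<mu> [measurable]: "T \<in> borel_measurable \<mu>"
    using \<mu>P1 by (simp add: P1D measurable_borel_sets_eq)
  define \<mu>' where "\<mu>' = distr \<mu> borel T"
  have "(\<integral>\<^sup>+ y. ennreal (dist x0 (T y)) \<partial>\<mu>) \<le> (\<integral>\<^sup>+ y. ennreal (dist x0 y) \<partial>\<mu>)"
    by (intro nn_integral_mono) (simp add: T_def)
  then have "(\<integral>\<^sup>+ y. ennreal (dist x0 y) \<partial>\<mu>') < \<infinity>"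
    unfolding \<mu>'_def using P1_moment[OF \<mu>P1, of x0] by (subst nn_integral_distr) (auto simp: le_less_trans)
  then have \<mu>'P1: "\<mu>' \<in> P1"
    by (auto simp: P1_def \<mu>'_def intro!: prob_space_distr)
  let ?h = "\<lambda>K y. if K < dist x0 y then dist x0 y else 0"
  have step: "W1 (nu i) \<mu>' + 1 / 2 * tail x0 (4 * K) \<mu> \<le> W1 (nu i) \<mu> + 2 * tail x0 K (nu i)"
    if i: "i < N" for i
  proof (rule W1_ge_by_couplings[OF nu[OF i] \<mu>P1])
    show "0 \<le> 2 * tail x0 K (nu i)" by (simp add: tail_nonneg)
    fix \<pi> :: "('a \<times> 'a) measure"
    assume \<pi>: "sets \<pi> = sets borel" "distr \<pi> borel fst = nu i" "distr \<pi> borel snd = \<mu>"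
    note m [measurable] = measurable_borel_sets_eq[OF \<pi>(1) measurable_fst_borel]
      measurable_borel_sets_eq[OF \<pi>(1) measurable_snd_borel]
    have "distr \<pi> borel (\<lambda>p. T (snd p)) = distr (distr \<pi> borel snd) borel T"
      by (simp add: distr_distr comp_def)
    then have \<mu>': "distr \<pi> borel (\<lambda>p. T (snd p)) = \<mu>'" by (simp add: \<pi> \<mu>'_def)
    have "ennreal (W1 (nu i) \<mu>' + 1 / 2 * tail x0 (4 * K) \<mu>)
        = ennW1 (nu i) \<mu>' + ennreal (1 / 2 * tail x0 (4 * K) \<mu>)"
      by (simp add: W1_nonneg tail_nonneg ennreal_W1[OF nu[OF i] \<mu>'P1])
    also have "\<dots> \<le> (\<integral>\<^sup>+ p. ennreal (dist (fst p) (T (snd p))) \<partial>\<pi>)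
        + ennreal (1 / 2 * tail x0 (4 * K) \<mu>)"
      by (intro add_mono ennW1_le \<pi> \<mu>') auto
    also have "ennreal (1 / 2 * tail x0 (4 * K) \<mu>) = (\<integral>\<^sup>+ p. ennreal (1 / 2 * ?h (4 * K) (snd p)) \<partial>\<pi>)"
      by (subst nn_integral_tail_distr[OF m(2) \<pi>(3) \<mu>P1]) auto
    also have "(\<integral>\<^sup>+ p. ennreal (dist (fst p) (T (snd p))) \<partial>\<pi>)
        + (\<integral>\<^sup>+ p. ennreal (1 / 2 * ?h (4 * K) (snd p)) \<partial>\<pi>)
        = (\<integral>\<^sup>+ p. ennreal (dist (fst p) (T (snd p))) + ennreal (1 / 2 * ?h (4 * K) (snd p)) \<partial>\<pi>)"
      by (intro nn_integral_add[symmetric]) auto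
    also have "\<dots> \<le> (\<integral>\<^sup>+ p. ennreal (dist (fst p) (snd p)) + ennreal (2 * ?h K (fst p)) \<partial>\<pi>)"
    proof (rule nn_integral_mono)
      fix p
      \<comment> \<open>Only y = \<open>snd p\<close> beyond 4K matters; let x =
        \<open>fst p\<close>. If x is within K, moving y to \<open>x0\<close> saves at least the
        distance from \<open>x0\<close> to y minus 2K, which is at least half of that distance. If x
        is beyond K, the triangle inequality through \<open>x0\<close> and the doubled term on the
        right suffice.\<close>
      have "dist (fst p) (T (snd p)) + 1 / 2 * ?h (4 * K) (snd p)
          \<le> dist (fst p) (snd p) + 2 * ?h K (fst p)"
        using dist_triangle[of x0 "snd p" "fst p"] K by (auto simp: T_def dist_commute)
      then show "ennreal (dist (fst p) (T (snd p))) + ennreal (1 / 2 * ?h (4 * K) (snd p))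
          \<le> ennreal (dist (fst p) (snd p)) + ennreal (2 * ?h K (fst p))"
        by (intro ennreal_add_le_addI) auto
    qed
    also have "\<dots> = (\<integral>\<^sup>+ p. ennreal (dist (fst p) (snd p)) \<partial>\<pi>) + (\<integral>\<^sup>+ p. ennreal (2 * ?h K (fst p)) \<partial>\<pi>)"
      by (intro nn_integral_add) auto
    also have "(\<integral>\<^sup>+ p. ennreal (2 * ?h K (fst p)) \<partial>\<pi>) = ennreal (2 * tail x0 K (nu i))"
      by (subst nn_integral_tail_distr[OF m(1) \<pi>(2) nu[OF i]]) auto
    finally show "ennreal (W1 (nu i) \<mu>' + 1 / 2 * tail x0 (4 * K) \<mu>)
        \<le> (\<integral>\<^sup>+ p. ennreal (dist (fst p) (snd p)) \<partial>\<pi>) + ennreal (2 * tail x0 K (nu i))" .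
  qed
  have lam': "0 \<le> lam i" if "i < N" for i
    using lam that by (simp add: unit_simplex_def)
  \<comment> \<open>Optimality of \<mu> is tested against \<mu>'. Because the weights sum to 1, the
    tail term can be distributed over all i and matched with \<open>step\<close>.\<close>
  have "(\<Sum>i<N. lam i * W1 (nu i) \<mu>) + 1 / 2 * tail x0 (4 * K) \<mu>
      \<le> (\<Sum>i<N. lam i * W1 (nu i) \<mu>') + (\<Sum>i<N. lam i) * (1 / 2 * tail x0 (4 * K) \<mu>)"
    using \<mu> \<mu>'P1 lam by (simp add: Med_def unit_simplex_def)
  also have "\<dots> = (\<Sum>i<N. lam i * (W1 (nu i) \<mu>' + 1 / 2 * tail x0 (4 * K) \<mu>))"
    by (simp add: sum.distrib distrib_left sum_distrib_right)
  also have "\<dots> \<le> (\<Sum>i<N. lam i * (W1 (nu i) \<mu> + 2 * tail x0 K (nu i)))"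
    using step lam' by (intro sum_mono mult_left_mono) auto
  also have "\<dots> = (\<Sum>i<N. lam i * W1 (nu i) \<mu>) + 2 * (\<Sum>i<N. lam i * tail x0 K (nu i))"
    by (simp add: sum.distrib distrib_left sum_distrib_left ac_simps)
  finally show ?thesis by simp
qed

end

section \<open>A real coding of proper metric spaces\<close>

text \<open>With digits 0 and 1 in base 3, the digits after position i contribute at most half of (1
  / 3)^i. Unlike in binary, a sufficiently good approximation therefore determines each digit. The
  values form a Cantor set scaled by 3 / 2.\<close>

definition ternary :: "(nat \<Rightarrow> bool) \<Rightarrow> real" where
  "ternary b = (\<Sum>i. of_bool (b i) * (1 / 3) ^ i)"

lemma summable_ternary: "summable (\<lambda>i. of_bool (b i) * (1 / 3 :: real) ^ i)"
  by (rule summable_comparison_test'[OF summable_geometric[of "1 / 3 :: real"], of 0]) auto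

lemma ternary_split: "ternary b = of_bool (b 0) + ternary (\<lambda>i. b (Suc i)) / 3"
proof -
  have "(\<Sum>i. of_bool (b (Suc i)) * (1 / 3 :: real) ^ Suc i) = ternary (\<lambda>i. b (Suc i)) / 3"
    using suminf_mult[OF summable_ternary[of "\<lambda>i. b (Suc i)"], of "1 / 3"]
    by (simp add: ternary_def ac_simps)
  then show ?thesis
    using suminf_split_head[OF summable_ternary[of b]] by (simp add: ternary_def)
qed

lemma ternary_nonneg: "0 \<le> ternary b"
  unfolding ternary_def by (intro suminf_nonneg summable_ternary) auto

lemma ternary_le: "ternary b \<le> 3 / 2"
proof -
  have "ternary b \<le> (\<Sum>i. (1 / 3 :: real) ^ i)"
    unfolding ternary_def by (intro suminf_le summable_ternary) (auto intro!: summable_geometric)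
  then show ?thesis using suminf_geometric[of "1 / 3 :: real"] by simp
qed

text \<open>If the leading digits differ, the values are at least 1 - 1 / 2 apart. If they agree,
  dropping them multiplies the difference by 3, which is the induction step.\<close>

lemma ternary_digit:
  "\<bar>ternary b - ternary b'\<bar> < 1 / 2 * (1 / 3) ^ i \<Longrightarrow> b i = b' i"
proof (induction i arbitrary: b b')
  case 0
  show ?case
  proof (rule ccontr)
    assume "b 0 \<noteq> b' 0"
    then show False
      using 0 ternary_split[of b] ternary_split[of b'] ternary_nonneg[of "\<lambda>i. b (Suc i)"]
        ternary_nonneg[of "\<lambda>i. b' (Suc i)"] ternary_le[of "\<lambda>i. b (Suc i)"]
        ternary_le[of "\<lambda>i. b' (Suc i)"]
      by (cases "b 0"; cases "b' 0") auto
  qed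
next
  case (Suc i)
  let ?s = "\<lambda>b i. b (Suc i) :: bool"
  have "b 0 = b' 0"
  proof (rule ccontr)
    assume "b 0 \<noteq> b' 0"
    then have "1 / 2 \<le> \<bar>ternary b - ternary b'\<bar>"
      using ternary_split[of b] ternary_split[of b'] ternary_nonneg[of "?s b"]
        ternary_nonneg[of "?s b'"] ternary_le[of "?s b"] ternary_le[of "?s b'"]
      by (cases "b 0"; cases "b' 0") auto
    moreover have "(1 / 3 :: real) ^ Suc i \<le> 1" by (intro power_le_one) auto
    ultimately show False using Suc.prems by linarith
  qed
  then have "\<bar>ternary (?s b) - ternary (?s b')\<bar> = 3 * \<bar>ternary b - ternary b'\<bar>"
    using ternary_split[of b] ternary_split[of b'] by (simp add: abs_if)
  then have "\<bar>ternary (?s b) - ternary (?s b')\<bar> < 1 / 2 * (1 / 3) ^ i"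
    using Suc.prems by simp
  from Suc.IH[OF this] show ?case .
qed

locale proper_metric = separable_metric d for d :: "nat \<Rightarrow> 'a::metric_space" +
  assumes compact_cball: "compact (cball (x :: 'a) r)"
begin

definition basic_ball :: "nat \<Rightarrow> 'a set" where
  "basic_ball i = ball (d (fst (prod_decode i))) (1 / real (Suc (snd (prod_decode i))))"

lemma open_basic_ball: "open (basic_ball i)"
  by (simp add: basic_ball_def)

lemma basic_ball_basis:
  assumes "0 < e"
  obtains i where "l \<in> basic_ball i" "basic_ball i \<subseteq> ball l e"
proof -
  obtain n where n: "1 / real (Suc n) < e / 2"
    using assms nat_approx_posE[of "e / 2"] by auto
  obtain k where k: "dist (d k) l < 1 / real (Suc n)"
    using dense[of "1 / real (Suc n)"] by auto
  show ?thesis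
  proof (rule that[of "prod_encode (k, n)"])
    show "l \<in> basic_ball (prod_encode (k, n))" using k by (simp add: basic_ball_def)
    show "basic_ball (prod_encode (k, n)) \<subseteq> ball l e"
    proof
      fix y assume "y \<in> basic_ball (prod_encode (k, n))"
      then have "dist (d k) y < 1 / real (Suc n)" by (simp add: basic_ball_def)
      then show "y \<in> ball l e"
        using k n dist_triangle3[of l y "d k"] by simp
    qed
  qed
qed

text \<open>
  The integer part keeps track of the distance to \<open>d 0\<close>, the ternary digits record membership in
  the basic balls. The factor \<open>2\<close> and the bound \<open>3 / 2\<close> on \<open>ternary\<close> keep the two parts apart.
\<close>

definition code :: "'a \<Rightarrow> real" where
  "code x = 2 * real_of_int \<lceil>dist (d 0) x\<rceil> + ternary (\<lambda>i. x \<in> basic_ball i)"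

lemma measurable_code [measurable]: "code \<in> borel_measurable borel"
proof -
  have [measurable]: "basic_ball i \<in> sets borel" for i
    by (simp add: open_basic_ball)
  show ?thesis unfolding code_def ternary_def by measurable
qed

text \<open>Distinct ceilings separate the integer parts by at least 2, of which the ternary parts
  can recover at most 3 / 2.\<close>

lemma code_ceiling:
  assumes "\<bar>code x - code y\<bar> < 1 / 2"
  shows "\<lceil>dist (d 0) x\<rceil> = \<lceil>dist (d 0) y\<rceil>"
proof (rule ccontr)
  assume "\<lceil>dist (d 0) x\<rceil> \<noteq> \<lceil>dist (d 0) y\<rceil>"
  then have "real_of_int \<lceil>dist (d 0) x\<rceil> + 1 \<le> real_of_int \<lceil>dist (d 0) y\<rceil>
      \<or> real_of_int \<lceil>dist (d 0) y\<rceil> + 1 \<le> real_of_int \<lceil>dist (d 0) x\<rceil>" by linarith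
  then show False
    using assms ternary_nonneg[of "\<lambda>i. x \<in> basic_ball i"] ternary_le[of "\<lambda>i. x \<in> basic_ball i"]
      ternary_nonneg[of "\<lambda>i. y \<in> basic_ball i"] ternary_le[of "\<lambda>i. y \<in> basic_ball i"]
    unfolding code_def by linarith
qed

lemma code_basic_ball:
  assumes "\<bar>code x - code y\<bar> < 1 / 2 * (1 / 3) ^ i"
  shows "x \<in> basic_ball i \<longleftrightarrow> y \<in> basic_ball i"
proof (rule ternary_digit)
  have "(1 / 3 :: real) ^ i \<le> 1" by (intro power_le_one) auto
  then have "\<lceil>dist (d 0) x\<rceil> = \<lceil>dist (d 0) y\<rceil>"
    using assms by (intro code_ceiling) simp
  then show "\<bar>ternary (\<lambda>i. x \<in> basic_ball i) - ternary (\<lambda>i. y \<in> basic_ball i)\<bar> < 1 / 2 * (1 / 3) ^ i"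
    using assms by (simp add: code_def)
qed

text \<open>For each i the codes of \<open>x n\<close> and \<open>y n\<close> eventually agree on
  membership in \<open>basic_ball i\<close>, so \<open>y n\<close> follows \<open>x n\<close> into
  every basic ball around \<open>l\<close>. Hence the limit depends on \<open>c\<close> alone, which
  makes \<open>decode\<close> well defined.\<close>

lemma code_same_limit:
  assumes x: "(\<lambda>n. code (x n)) \<longlonglongrightarrow> c" "x \<longlonglongrightarrow> l" and y: "(\<lambda>n. code (y n)) \<longlonglongrightarrow> c"
  shows "y \<longlonglongrightarrow> l"
proof (rule tendstoI)
  fix e :: real assume "0 < e"
  then obtain i where i: "l \<in> basic_ball i" "basic_ball i \<subseteq> ball l e"
    by (rule basic_ball_basis)
  have "(\<lambda>n. code (x n) - code (y n)) \<longlonglongrightarrow> 0"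
    using tendsto_diff[OF x(1) y] by simp
  then have "\<forall>\<^sub>F n in sequentially. dist (code (x n) - code (y n)) 0 < 1 / 2 * (1 / 3) ^ i"
    by (rule tendstoD) simp
  moreover have "\<forall>\<^sub>F n in sequentially. x n \<in> basic_ball i"
    by (rule topological_tendstoD[OF x(2) open_basic_ball i(1)])
  ultimately show "\<forall>\<^sub>F n in sequentially. dist (y n) l < e"
  proof eventually_elim
    case (elim n)
    then have "y n \<in> basic_ball i" using code_basic_ball[of "x n" "y n" i] by simp
    with i(2) show ?case by (auto simp: dist_commute)
  qed
qed

text \<open>This is where properness enters. The integer part of the code is eventually constant, so
  a tail of the sequence stays in a compact ball and has a convergent subsequence. By
  \<open>code_same_limit\<close>, applied to that subsequence and the corresponding indices, the
  whole sequence has the same limit.\<close>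

lemma code_convergent:
  assumes c: "(\<lambda>n. code (x n)) \<longlonglongrightarrow> c"
  obtains l where "x \<longlonglongrightarrow> l"
proof -
  have cauchy: "\<exists>M. \<forall>n\<ge>M. \<forall>m\<ge>M. \<bar>code (x n) - code (x m)\<bar> < e" if "0 < e" for e
    using metric_CauchyD[OF LIMSEQ_imp_Cauchy[OF c] that] by (simp add: dist_real_def)
  obtain M where M: "\<And>n. M \<le> n \<Longrightarrow> \<bar>code (x n) - code (x M)\<bar> < 1 / 2"
    using cauchy[of "1 / 2"] by auto
  let ?B = "cball (d 0) (real_of_int \<lceil>dist (d 0) (x M)\<rceil>)"
  have "x (n + M) \<in> ?B" for n
    using le_of_int_ceiling[of "dist (d 0) (x (n + M))"] code_ceiling[OF M[of "n + M"]] by simp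
  then obtain l r where r: "strict_mono r" "((\<lambda>n. x (n + M)) \<circ> r) \<longlonglongrightarrow> l"
    using compact_imp_seq_compact[OF compact_cball] unfolding seq_compact_def by meson
  have "strict_mono (\<lambda>n. r n + M)"
    using r(1) by (simp add: strict_mono_def)
  then have "(\<lambda>n. code (x (r n + M))) \<longlonglongrightarrow> c"
    using LIMSEQ_subseq_LIMSEQ[OF c, of "\<lambda>n. r n + M"] by (simp add: comp_def)
  from code_same_limit[OF this _ c] have "x \<longlonglongrightarrow> l"
    using r(2) by (simp add: comp_def)
  then show ?thesis by (rule that)
qed

text \<open>The common limit of all sequences whose codes tend to \<open>c\<close> extends the
  inverse of \<open>code\<close> to the closure of its range. The constant value off this closed set
  keeps the function Borel.\<close>

definition decode :: "real \<Rightarrow> 'a" where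
  "decode c = (if c \<in> closure (range code)
    then SOME l. \<forall>x. (\<lambda>n. code (x n)) \<longlonglongrightarrow> c \<longrightarrow> x \<longlonglongrightarrow> l else d 0)"

lemma tendsto_decode:
  assumes c: "c \<in> closure (range code)" and x: "(\<lambda>n. code (x n)) \<longlonglongrightarrow> c"
  shows "x \<longlonglongrightarrow> decode c"
proof -
  obtain l where "x \<longlonglongrightarrow> l" using x by (rule code_convergent)
  then have "\<exists>l. \<forall>y. (\<lambda>n. code (y n)) \<longlonglongrightarrow> c \<longrightarrow> y \<longlonglongrightarrow> l"
    using code_same_limit[OF x] by blast
  from someI_ex[OF this] show ?thesis
    using c x by (simp add: decode_def)
qed

lemma decode_code: "decode (code x) = x"
proof -
  have "code x \<in> closure (range code)" by (rule subsetD[OF closure_subset rangeI])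
  from tendsto_decode[OF this, of "\<lambda>n. x"] have "(\<lambda>n. x) \<longlonglongrightarrow> decode (code x)"
    by simp
  from LIMSEQ_unique[OF this tendsto_const] show ?thesis .
qed

text \<open>Each \<open>c n\<close> in the closure is replaced by an actual code
  \<open>code (z n)\<close>, with \<open>z n\<close> also close to \<open>decode (c n)\<close>, both
  within 1 / (n + 1). The codes of \<open>z n\<close> then tend to \<open>c0\<close>, and
  \<open>tendsto_decode\<close> applies to \<open>z\<close>.\<close>

lemma continuous_on_decode: "continuous_on (closure (range code)) decode"
  unfolding continuous_on_sequentially
proof (intro allI ballI impI)
  fix c :: "nat \<Rightarrow> real" and c0
  assume c0: "c0 \<in> closure (range code)" and c: "(\<forall>n. c n \<in> closure (range code)) \<and> c \<longlonglongrightarrow> c0"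
  have "\<exists>z. \<bar>code z - c n\<bar> < 1 / real (Suc n) \<and> dist z (decode (c n)) < 1 / real (Suc n)" for n
  proof -
    obtain y where y: "\<And>m. y m \<in> range code" "y \<longlonglongrightarrow> c n"
      using c unfolding closure_sequential by metis
    have "\<forall>m. \<exists>z. y m = code z" using y(1) by auto
    then obtain z where "\<forall>m. y m = code (z m)" by metis
    then have "y = (\<lambda>m. code (z m))" by auto
    with y(2) have z: "(\<lambda>m. code (z m)) \<longlonglongrightarrow> c n" by simp
    have z': "z \<longlonglongrightarrow> decode (c n)" using c z by (intro tendsto_decode) auto
    have "\<forall>\<^sub>F m in sequentially. dist (code (z m)) (c n) < 1 / real (Suc n)"
      "\<forall>\<^sub>F m in sequentially. dist (z m) (decode (c n)) < 1 / real (Suc n)"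
      by (auto intro: tendstoD[OF z] tendstoD[OF z'])
    then have "\<forall>\<^sub>F m in sequentially. \<bar>code (z m) - c n\<bar> < 1 / real (Suc n)
        \<and> dist (z m) (decode (c n)) < 1 / real (Suc n)"
      by eventually_elim (simp add: dist_real_def)
    then show ?thesis using eventually_happens' sequentially_bot by blast
  qed
  then obtain z where z: "\<And>n. \<bar>code (z n) - c n\<bar> < 1 / real (Suc n)"
    "\<And>n. dist (z n) (decode (c n)) < 1 / real (Suc n)" by metis
  have null: "(\<lambda>n. 1 / real (Suc n)) \<longlonglongrightarrow> 0"
    using LIMSEQ_inverse_real_of_nat by (simp add: inverse_eq_divide)
  have "(\<lambda>n. code (z n) - c n) \<longlonglongrightarrow> 0"
    using z(1) by (intro Lim_null_comparison[OF _ null] always_eventually allI)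
      (simp add: less_imp_le del: of_nat_Suc)
  from tendsto_add[OF this, of c c0] have "(\<lambda>n. code (z n)) \<longlonglongrightarrow> c0"
    using c by simp
  then have "z \<longlonglongrightarrow> decode c0" by (rule tendsto_decode[OF c0])
  then have "(\<lambda>n. dist (z n) (decode c0)) \<longlonglongrightarrow> 0" by (rule iffD1[OF tendsto_dist_iff])
  from tendsto_add[OF null this] have lim: "(\<lambda>n. 1 / real (Suc n) + dist (z n) (decode c0)) \<longlonglongrightarrow> 0"
    by simp
  have "(\<lambda>n. dist (decode (c n)) (decode c0)) \<longlonglongrightarrow> 0"
  proof (rule Lim_null_comparison[OF _ lim], intro always_eventually allI)
    fix n
    show "norm (dist (decode (c n)) (decode c0)) \<le> 1 / real (Suc n) + dist (z n) (decode c0)"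
      using z(2)[of n] dist_triangle3[of "decode (c n)" "decode c0" "z n"] by simp
  qed
  then show "(decode \<circ> c) \<longlonglongrightarrow> decode c0"
    unfolding comp_def by (rule iffD2[OF tendsto_dist_iff])
qed

lemma measurable_decode [measurable]: "decode \<in> borel_measurable borel"
proof -
  let ?C = "closure (range code)"
  have "(\<lambda>c. if c \<in> ?C then decode c else d 0) \<in> borel_measurable borel"
    by (intro borel_measurable_continuous_on_if continuous_on_decode) auto
  moreover have "(\<lambda>c. if c \<in> ?C then decode c else d 0) = decode"
    by (auto simp: decode_def)
  ultimately show ?thesis by simp
qed

section \<open>Tightness of the coded laws and almost sure representation\<close>

lemma tight_code:
  assumes P1: "\<And>n :: nat. \<mu> n \<in> P1"
    and ui: "\<And>e. 0 < e \<Longrightarrow> \<exists>K\<ge>0. \<forall>n. tail (d 0) K (\<mu> n) < e"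
  shows "tight (\<lambda>n. distr (\<mu> n) borel code)"
  unfolding tight_def
proof (intro conjI allI impI)
  fix n
  interpret prob_space "\<mu> n" using P1 by (simp add: P1D)
  show "real_distribution (distr (\<mu> n) borel code)"
    using P1[of n] by (intro real_distribution_distr) (simp add: P1D measurable_borel_sets_eq)
next
  fix e :: real assume "0 < e"
  then obtain K where K: "0 \<le> K" "\<And>n. tail (d 0) K (\<mu> n) < e" using ui by blast
  \<comment> \<open>A radius of at least 1 makes the indicator of the far set smaller than the
    distance, so the mass outside the ball is at most the tail.\<close>
  let ?L = "max K 1"
  \<comment> \<open>Within radius \<open>?L\<close> the ceiling is at most \<open>?L + 1\<close> and
    the ternary part at most 3 / 2, and codes are nonnegative. The left end -1 accounts for the
    interval being open there.\<close>
  have "1 - e < measure (distr (\<mu> n) borel code) {-1<..2 * (?L + 1) + 3 / 2}" for n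
  proof -
    interpret prob_space "\<mu> n" using P1 by (simp add: P1D)
    have [measurable]: "code \<in> borel_measurable (\<mu> n)" "(\<lambda>x. x) \<in> borel_measurable (\<mu> n)"
      using P1[of n] by (auto simp: P1D measurable_borel_sets_eq)
    have sp: "space (\<mu> n) = UNIV"
      using sets_eq_imp_space_eq[OF P1D(2)[OF P1]] by simp
    let ?far = "{y \<in> space (\<mu> n). ?L < dist (d 0) y}"
    have "ennreal (prob ?far) = (\<integral>\<^sup>+ y. indicator ?far y \<partial>\<mu> n)"
      by (simp add: emeasure_eq_measure)
    also have "\<dots> \<le> ennreal (tail (d 0) ?L (\<mu> n))"
      unfolding ennreal_tail[OF P1] by (intro nn_integral_mono) (auto simp: indicator_def)
    finally have "prob ?far \<le> tail (d 0) ?L (\<mu> n)"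
      by (simp add: ennreal_le_iff tail_nonneg)
    also have "\<dots> \<le> tail (d 0) K (\<mu> n)" by (intro tail_antimono P1) simp
    finally have "1 - e < prob (space (\<mu> n) - ?far)"
      using K(2)[of n] by (subst prob_compl) auto
    also have "\<dots> \<le> prob (code -` {-1<..2 * (?L + 1) + 3 / 2} \<inter> space (\<mu> n))"
    proof (rule finite_measure_mono)
      have "code y \<in> {-1<..2 * (?L + 1) + 3 / 2}" if "dist (d 0) y \<le> ?L" for y
      proof -
        have "0 \<le> real_of_int \<lceil>dist (d 0) y\<rceil>"
          by (rule order_trans[OF zero_le_dist le_of_int_ceiling])
        then have "- 1 < code y"
          using ternary_nonneg[of "\<lambda>i. y \<in> basic_ball i"] unfolding code_def by linarith
        moreover have "real_of_int \<lceil>dist (d 0) y\<rceil> \<le> ?L + 1"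
          using of_int_ceiling_le_add_one[of "dist (d 0) y"] that by linarith
        then have "code y \<le> 2 * (?L + 1) + 3 / 2"
          using ternary_le[of "\<lambda>i. y \<in> basic_ball i"] unfolding code_def
          by (intro add_mono mult_left_mono) auto
        ultimately show ?thesis
          by simp
      qed
      then show "space (\<mu> n) - ?far \<subseteq> code -` {-1<..2 * (?L + 1) + 3 / 2} \<inter> space (\<mu> n)"
        by auto
    qed measurable
    also have "\<dots> = measure (distr (\<mu> n) borel code) {-1<..2 * (?L + 1) + 3 / 2}"
      by (subst measure_distr) auto
    finally show ?thesis .
  qed
  then show "\<exists>a b. a < b \<and> (\<forall>n. 1 - e < measure (distr (\<mu> n) borel code) {a<..b})"
    by (intro exI[of _ "-1"] exI[of _ "2 * (?L + 1) + 3 / 2"]) auto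
qed

text \<open>Weak convergence of a subsequence of the coded laws is represented on the line by
  variables \<open>V n\<close> converging to \<open>W\<close>. Decoding them restores the laws
  \<open>\<mu> (r n)\<close> because \<open>decode\<close> inverts \<open>code\<close>, and
  preserves convergence because \<open>decode\<close> is continuous.\<close>

lemma tight_Skorohod:
  assumes P1: "\<And>n :: nat. \<mu> n \<in> P1"
    and ui: "\<And>e. 0 < e \<Longrightarrow> \<exists>K\<ge>0. \<forall>n. tail (d 0) K (\<mu> n) < e"
  obtains r and \<Omega> :: "real measure" and X Y where "strict_mono (r :: nat \<Rightarrow> nat)" "prob_space \<Omega>"
    "\<And>n. X n \<in> borel_measurable \<Omega>" "Y \<in> borel_measurable \<Omega>"
    "\<And>n. distr \<Omega> borel (X n) = \<mu> (r n)" "AE \<omega> in \<Omega>. (\<lambda>n. X n \<omega>) \<longlonglongrightarrow> Y \<omega>"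
proof -
  let ?C = "closure (range code)"
  have tight: "tight (\<lambda>n. distr (\<mu> n) borel code)" using P1 ui by (rule tight_code)
  obtain r M where r: "strict_mono r" and M: "real_distribution M"
    and w: "weak_conv_m ((\<lambda>n. distr (\<mu> n) borel code) \<circ> id \<circ> r) M"
    using tight_imp_convergent_subsubsequence[OF tight strict_mono_id] by blast
  have dist: "real_distribution (((\<lambda>n. distr (\<mu> n) borel code) \<circ> id \<circ> r) n)" for n
    using tight by (simp add: tight_def)
  obtain \<Omega> :: "real measure" and V W where \<Omega>: "prob_space \<Omega>"
    and V: "\<forall>n. V n \<in> borel_measurable \<Omega>"
    and law: "\<forall>n. distr \<Omega> borel (V n) = distr (\<mu> (r n)) borel code"
    and W: "W \<in> measurable \<Omega> lborel" and lim: "\<forall>\<omega>\<in>space \<Omega>. (\<lambda>n. V n \<omega>) \<longlonglongrightarrow> W \<omega>"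
    using Skorohod[OF dist M w] unfolding comp_def id_def by blast
  have [measurable]: "V n \<in> borel_measurable \<Omega>" for n using V by simp
  have [measurable]: "W \<in> borel_measurable \<Omega>" using W by simp
  have code_\<mu> [measurable]: "code \<in> borel_measurable (\<mu> n)" for n
    using P1[of n] by (simp add: P1D measurable_borel_sets_eq)
  \<comment> \<open>The closure is used in place of the range: it is Borel, and being closed it also
    contains the limit \<open>W \<omega>\<close>.\<close>
  have "AE \<omega> in \<Omega>. V n \<omega> \<in> ?C" for n
  proof -
    have "AE x in \<mu> (r n). code x \<in> ?C"
      using closure_subset[of "range code"] by auto
    then have "AE c in distr (\<mu> (r n)) borel code. c \<in> ?C"
      by (subst AE_distr_iff) auto
    then have "AE c in distr \<Omega> borel (V n). c \<in> ?C"
      unfolding law[rule_format] .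
    then show ?thesis by (subst (asm) AE_distr_iff) auto
  qed
  then have "AE \<omega> in \<Omega>. \<forall>n. V n \<omega> \<in> ?C" by (simp add: AE_all_countable)
  then have "AE \<omega> in \<Omega>. (\<lambda>n. decode (V n \<omega>)) \<longlonglongrightarrow> decode (W \<omega>)"
  proof (rule AE_mp, intro AE_I2 impI)
    fix \<omega> assume \<omega>: "\<omega> \<in> space \<Omega>" and V: "\<forall>n. V n \<omega> \<in> ?C"
    have l: "(\<lambda>n. V n \<omega>) \<longlonglongrightarrow> W \<omega>" using lim \<omega> by simp
    have "W \<omega> \<in> ?C" by (rule closed_sequentially[OF closed_closure _ l]) (simp add: V)
    then show "(\<lambda>n. decode (V n \<omega>)) \<longlonglongrightarrow> decode (W \<omega>)"
      using continuous_on_decode V l unfolding continuous_on_sequentially by (auto simp: comp_def)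
  qed
  moreover have "distr \<Omega> borel (\<lambda>\<omega>. decode (V n \<omega>)) = \<mu> (r n)" for n
  proof -
    have "distr \<Omega> borel (\<lambda>\<omega>. decode (V n \<omega>)) = distr (distr \<Omega> borel (V n)) borel decode"
      by (simp add: distr_distr comp_def)
    also have "\<dots> = distr (\<mu> (r n)) borel (\<lambda>x. x)"
      by (simp add: law distr_distr comp_def decode_code)
    finally show ?thesis using P1 by (simp add: distr_id2 P1D)
  qed
  ultimately show ?thesis
    using that[of r \<Omega> "\<lambda>n \<omega>. decode (V n \<omega>)" "\<lambda>\<omega>. decode (W \<omega>)"] r \<Omega> by simp
qed

end

section \<open>Compactness and closed graph\<close>

context proper_metric
begin

text \<open>The joint law of \<open>X n\<close> and \<open>Y\<close> from
  \<open>tight_Skorohod\<close> is a coupling whose cost tends to 0, as in Vitali's theorem: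
  dominated convergence handles the part where \<open>X n\<close> is near the base point, and the
  uniform tails handle the rest.\<close>

theorem uniformly_integrable_W1_convergent_subsequence:
  assumes P1: "\<And>n :: nat. \<mu> n \<in> P1"
    and ui: "\<And>e. 0 < e \<Longrightarrow> \<exists>K\<ge>0. \<forall>n. tail (d 0) K (\<mu> n) < e"
  obtains r \<nu> where "strict_mono (r :: nat \<Rightarrow> nat)" "\<nu> \<in> P1" "(\<lambda>n. W1 (\<mu> (r n)) \<nu>) \<longlonglongrightarrow> 0"
proof -
  obtain r and \<Omega> :: "real measure" and X Y where r: "strict_mono (r :: nat \<Rightarrow> nat)"
    and "prob_space \<Omega>"
    and X [measurable]: "\<And>n. X n \<in> borel_measurable \<Omega>" and Y [measurable]: "Y \<in> borel_measurable \<Omega>"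
    and law: "\<And>n. distr \<Omega> borel (X n) = \<mu> (r n)" and lim: "AE \<omega> in \<Omega>. (\<lambda>n. X n \<omega>) \<longlonglongrightarrow> Y \<omega>"
    using tight_Skorohod[of \<mu>] P1 ui by blast
  interpret prob_space \<Omega> by fact
  define \<nu> where "\<nu> = distr \<Omega> borel Y"
  let ?a = "\<lambda>y. dist (d 0) y"
  let ?h = "\<lambda>K y. if K < ?a y then ?a y else 0"
  \<comment> \<open>Fatou's lemma: if the limit point lies strictly beyond \<open>K\<close>, so do
    the approximating points eventually, hence the integrand at \<open>Y\<close> is at most the
    lower limit of those at \<open>X n\<close>.\<close>
  have tail_Y: "(\<integral>\<^sup>+ \<omega>. ennreal (?h K (Y \<omega>)) \<partial>\<Omega>) \<le> ennreal e"
    if K: "\<And>n. tail (d 0) K (\<mu> n) < e" for K e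
  proof -
    have "(\<integral>\<^sup>+ \<omega>. ennreal (?h K (Y \<omega>)) \<partial>\<Omega>) \<le> (\<integral>\<^sup>+ \<omega>. liminf (\<lambda>n. ennreal (?h K (X n \<omega>))) \<partial>\<Omega>)"
    proof (rule nn_integral_mono_AE, use lim in eventually_elim)
      case (elim \<omega>)
      show ?case
      proof (cases "K < ?a (Y \<omega>)")
        case True
        have a: "(\<lambda>n. ?a (X n \<omega>)) \<longlonglongrightarrow> ?a (Y \<omega>)"
          by (intro tendsto_intros elim)
        have "\<forall>\<^sub>F n in sequentially. ennreal (?a (X n \<omega>)) = ennreal (?h K (X n \<omega>))"
          using order_tendstoD(1)[OF a True] by eventually_elim simp
        moreover have "(\<lambda>n. ennreal (?a (X n \<omega>))) \<longlonglongrightarrow> ennreal (?a (Y \<omega>))"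
          by (rule tendsto_ennrealI[OF a])
        ultimately have "(\<lambda>n. ennreal (?h K (X n \<omega>))) \<longlonglongrightarrow> ennreal (?a (Y \<omega>))"
          by (rule Lim_transform_eventually[rotated])
        from lim_imp_Liminf[OF _ this] True show ?thesis by simp
      qed simp
    qed
    also have "\<dots> \<le> liminf (\<lambda>n. \<integral>\<^sup>+ \<omega>. ennreal (?h K (X n \<omega>)) \<partial>\<Omega>)"
      by (intro nn_integral_liminf) measurable
    also have "\<dots> \<le> liminf (\<lambda>n. ennreal e)"
    proof (intro Liminf_mono always_eventually allI)
      fix n
      show "(\<integral>\<^sup>+ \<omega>. ennreal (?h K (X n \<omega>)) \<partial>\<Omega>) \<le> ennreal e"
        using nn_integral_tail_distr[OF X law P1, of 1 K "d 0"] K[of "r n"]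
        by (simp add: ennreal_leI less_imp_le)
    qed
    also have "\<dots> = ennreal e" by (simp add: Liminf_const)
    finally show ?thesis .
  qed
  have Y_int: "(\<integral>\<^sup>+ \<omega>. ennreal (?a (Y \<omega>)) \<partial>\<Omega>) < \<infinity>"
  proof -
    obtain K where K: "0 \<le> K" "\<And>n. tail (d 0) K (\<mu> n) < 1" using ui[of 1] by auto
    have "(\<integral>\<^sup>+ \<omega>. ennreal (?a (Y \<omega>)) \<partial>\<Omega>) \<le> (\<integral>\<^sup>+ \<omega>. ennreal K + ennreal (?h K (Y \<omega>)) \<partial>\<Omega>)"
      using K(1) by (intro nn_integral_mono ennreal_le_addI) auto
    also have "\<dots> = ennreal K + (\<integral>\<^sup>+ \<omega>. ennreal (?h K (Y \<omega>)) \<partial>\<Omega>)"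
      by (subst nn_integral_add) (auto simp: emeasure_space_1)
    also have "\<dots> \<le> ennreal K + ennreal 1"
      by (intro add_left_mono tail_Y K)
    finally show ?thesis by (simp add: le_less_trans)
  qed
  have "(\<integral>\<^sup>+ y. ennreal (dist (d 0) y) \<partial>\<nu>) < \<infinity>"
    unfolding \<nu>_def using Y_int by (subst nn_integral_distr) auto
  then have \<nu>P1: "\<nu> \<in> P1"
    by (auto simp: P1_def \<nu>_def intro!: prob_space_distr)
  have "(\<lambda>n. W1 (\<mu> (r n)) \<nu>) \<longlonglongrightarrow> 0"
  proof (rule order_tendstoI)
    fix a :: real assume "a < 0"
    then show "\<forall>\<^sub>F n in sequentially. a < W1 (\<mu> (r n)) \<nu>"
      by (auto intro: always_eventually less_le_trans[OF _ W1_nonneg])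
  next
    fix a :: real assume "0 < a"
    \<comment> \<open>The cost will be bounded by 4 * e: one e from \<open>J n\<close>, two from the
      tail of \<open>X n\<close>, one from that of \<open>Y\<close>.\<close>
    define e where "e = a / 8"
    have e: "0 < e" using \<open>0 < a\<close> by (simp add: e_def)
    then obtain K where K: "0 \<le> K" "\<And>n. tail (d 0) K (\<mu> n) < e" using ui by blast
    \<comment> \<open>Truncating in \<open>X n\<close> alone gives the integrable majorant
      \<open>K\<close> plus the distance from the base point to \<open>Y\<close>, which is
      independent of n.\<close>
    define J where "J n = (\<integral>\<^sup>+ \<omega>. ennreal (if ?a (X n \<omega>) \<le> K then dist (X n \<omega>) (Y \<omega>) else 0) \<partial>\<Omega>)" for n
    have "J \<longlonglongrightarrow> (\<integral>\<^sup>+ \<omega>. 0 \<partial>\<Omega>)"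
      unfolding J_def
    proof (rule nn_integral_dominated_convergence[where w = "\<lambda>\<omega>. ennreal K + ennreal (?a (Y \<omega>))"])
      show "AE \<omega> in \<Omega>. ennreal (if ?a (X n \<omega>) \<le> K then dist (X n \<omega>) (Y \<omega>) else 0)
          \<le> ennreal K + ennreal (?a (Y \<omega>))" for n
      proof (rule AE_I2, rule ennreal_le_addI)
        fix \<omega>
        show "(if ?a (X n \<omega>) \<le> K then dist (X n \<omega>) (Y \<omega>) else 0) \<le> K + ?a (Y \<omega>)"
          using dist_triangle3[of "X n \<omega>" "Y \<omega>" "d 0"] K(1) by simp
      qed (use K in auto)
      show "AE \<omega> in \<Omega>. (\<lambda>n. ennreal (if ?a (X n \<omega>) \<le> K then dist (X n \<omega>) (Y \<omega>) else 0)) \<longlonglongrightarrow> 0"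
        using lim
      proof eventually_elim
        case (elim \<omega>)
        then have l: "(\<lambda>n. dist (X n \<omega>) (Y \<omega>)) \<longlonglongrightarrow> 0" by (rule iffD1[OF tendsto_dist_iff])
        have "(\<lambda>n. if ?a (X n \<omega>) \<le> K then dist (X n \<omega>) (Y \<omega>) else 0) \<longlonglongrightarrow> 0"
          by (rule Lim_null_comparison[OF _ l]) (auto intro!: always_eventually)
        from tendsto_ennrealI[OF this] show ?case by simp
      qed
      show "(\<integral>\<^sup>+ \<omega>. ennreal K + ennreal (?a (Y \<omega>)) \<partial>\<Omega>) < \<infinity>"
        using Y_int by (subst nn_integral_add) (auto simp: emeasure_space_1)
    qed measurable
    then have "J \<longlonglongrightarrow> 0" by simp
    then have "\<forall>\<^sub>F n in sequentially. J n < ennreal e"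
      using e by (intro order_tendstoD) auto
    then show "\<forall>\<^sub>F n in sequentially. W1 (\<mu> (r n)) \<nu> < a"
    proof eventually_elim
      case (elim n)
      have tX: "(\<integral>\<^sup>+ \<omega>. ennreal (2 * ?h K (X n \<omega>)) \<partial>\<Omega>) \<le> ennreal (2 * e)"
        using nn_integral_tail_distr[OF X law P1, of 2 K "d 0"] K(2)[of "r n"]
        by (simp add: ennreal_leI less_imp_le)
      have "ennreal (W1 (\<mu> (r n)) \<nu>) = ennW1 (\<mu> (r n)) \<nu>"
        by (intro ennreal_W1 P1 \<nu>P1)
      also have "\<dots> \<le> (\<integral>\<^sup>+ \<omega>. ennreal (dist (X n \<omega>) (Y \<omega>)) \<partial>\<Omega>)"
        by (intro ennW1_le X Y law \<nu>_def[symmetric])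
      also have "\<dots> \<le> (\<integral>\<^sup>+ \<omega>. ennreal (if ?a (X n \<omega>) \<le> K then dist (X n \<omega>) (Y \<omega>) else 0)
          + ennreal (2 * ?h K (X n \<omega>) + ?h K (Y \<omega>)) \<partial>\<Omega>)"
      proof (rule nn_integral_mono, rule ennreal_le_addI)
        fix \<omega>
        \<comment> \<open>If \<open>X n\<close> is beyond \<open>K\<close>, the distance is at most
          the sum of the two distances to the base point. When \<open>Y\<close> is within
          \<open>K\<close>, its share is below that of \<open>X n\<close>, hence the factor
          2.\<close>
        show "dist (X n \<omega>) (Y \<omega>) \<le> (if ?a (X n \<omega>) \<le> K then dist (X n \<omega>) (Y \<omega>) else 0)
            + (2 * ?h K (X n \<omega>) + ?h K (Y \<omega>))"
          using dist_triangle3[of "X n \<omega>" "Y \<omega>" "d 0"] K(1) by simp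
      qed auto
      also have "\<dots> = J n + ((\<integral>\<^sup>+ \<omega>. ennreal (2 * ?h K (X n \<omega>)) \<partial>\<Omega>)
          + (\<integral>\<^sup>+ \<omega>. ennreal (?h K (Y \<omega>)) \<partial>\<Omega>))"
        unfolding J_def by (subst ennreal_plus) (auto simp: nn_integral_add)
      also have "\<dots> \<le> J n + (ennreal (2 * e) + ennreal e)"
        by (intro add_left_mono add_mono tX tail_Y K(2))
      also have "\<dots> \<le> ennreal e + (ennreal (2 * e) + ennreal e)"
        using elim by (intro add_right_mono less_imp_le)
      also have "\<dots> = ennreal (4 * e)"
        using e by (simp flip: ennreal_plus)
      finally have "W1 (\<mu> (r n)) \<nu> \<le> 4 * e"
        using e by (subst (asm) ennreal_le_iff) auto
      then show ?case using \<open>0 < a\<close> by (simp add: e_def)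
    qed
  qed
  with r \<nu>P1 show ?thesis by (rule that)
qed

section \<open>Uniform integrability of medians\<close>

lemma uniform_tail_finite:
  assumes "finite I" "\<And>i. i \<in> I \<Longrightarrow> \<nu> i \<in> P1" "0 < e"
  obtains K where "0 \<le> K" "\<And>i L. i \<in> I \<Longrightarrow> K \<le> L \<Longrightarrow> tail (x0 :: 'a) L (\<nu> i) < e"
proof -
  have "\<forall>i\<in>I. \<exists>K\<ge>0. \<forall>L\<ge>K. tail x0 L (\<nu> i) < e"
    using tail_small[OF assms(2) assms(3)] by metis
  then obtain K where K: "\<And>i. i \<in> I \<Longrightarrow> 0 \<le> K i" "\<And>i L. i \<in> I \<Longrightarrow> K i \<le> L \<Longrightarrow> tail x0 L (\<nu> i) < e"
    by metis
  show ?thesis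
  proof (rule that[of "Max (insert 0 (K ` I))"])
    show "0 \<le> Max (insert 0 (K ` I))" using assms(1) by simp
    fix i L assume "i \<in> I" and L: "Max (insert 0 (K ` I)) \<le> L"
    then have "K i \<le> L" using assms(1) by (auto intro: order_trans[OF Max_ge])
    then show "tail x0 L (\<nu> i) < e" using K(2) \<open>i \<in> I\<close> by simp
  qed
qed

text \<open>For large n the data are close to \<open>nu\<close>, so \<open>tail_le_W1_tail\<close>
  and then \<open>Med_tail\<close> carry the tail bound from \<open>nu\<close> to the medians. The
  finitely many remaining medians have small tails individually.\<close>

lemma Med_uniformly_integrable:
  assumes nu: "\<And>i. i < N \<Longrightarrow> nu i \<in> P1"
    and lams: "\<And>n. unit_simplex N (lams n)" and nus: "\<And>n i. i < N \<Longrightarrow> nus n i \<in> P1"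
    and conv: "\<And>i. i < N \<Longrightarrow> (\<lambda>n. W1 (nus n i) (nu i)) \<longlonglongrightarrow> 0"
    and mus: "\<And>n. mus n \<in> Med N (lams n) (nus n)"
    and e: "0 < e"
  shows "\<exists>K\<ge>0. \<forall>n. tail (x0 :: 'a) K (mus n) < e"
proof -
  have P1: "mus n \<in> P1" for n using mus[of n] by (simp add: Med_def)
  \<comment> \<open>With e / 32, the data have tails at most e / 8 beyond 2K, so late medians have
    tails at most e / 2 beyond 8K.\<close>
  obtain K where K: "0 \<le> K" "\<And>i L. i \<in> {..<N} \<Longrightarrow> K \<le> L \<Longrightarrow> tail x0 L (nu i) < e / 32"
    by (rule uniform_tail_finite[of "{..<N}" nu "e / 32" x0]) (use nu e in auto)
  have "\<forall>\<^sub>F n in sequentially. \<forall>i\<in>{..<N}. W1 (nus n i) (nu i) < e / 32"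
    using conv e by (intro eventually_ball_finite ballI order_tendstoD) auto
  then obtain n0 where n0: "\<And>n i. n0 \<le> n \<Longrightarrow> i < N \<Longrightarrow> W1 (nus n i) (nu i) < e / 32"
    by (auto simp: eventually_sequentially)
  have late: "tail x0 (8 * K) (mus n) < e" if n: "n0 \<le> n" for n
  proof -
    have "tail x0 (2 * K) (nus n i) \<le> e / 8" if i: "i < N" for i
      using tail_le_W1_tail[OF nu[OF i] nus[OF i] K(1), of x0 n] K(2)[of i K] i n0[OF n i]
      by (simp add: W1_commute[of "nu i"])
    then have "(\<Sum>i<N. lams n i * tail x0 (2 * K) (nus n i)) \<le> (\<Sum>i<N. lams n i * (e / 8))"
      using lams[of n] by (intro sum_mono mult_left_mono) (auto simp: unit_simplex_def)
    also have "\<dots> = e / 8"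
      using lams[of n] by (simp add: unit_simplex_def flip: sum_distrib_right sum_divide_distrib)
    finally show ?thesis
      using Med_tail[OF lams[of n] nus mus[of n], of "2 * K" x0] K(1) e by simp
  qed
  obtain L where L: "0 \<le> L" "\<And>n M. n \<in> {..<n0} \<Longrightarrow> L \<le> M \<Longrightarrow> tail x0 M (mus n) < e"
    by (rule uniform_tail_finite[of "{..<n0}" mus e x0]) (use P1 e in auto)
  have "tail x0 (max L (8 * K)) (mus n) < e" for n
  proof (cases "n < n0")
    case False
    then show ?thesis
      using late[of n] tail_antimono[OF P1[of n], of "8 * K" "max L (8 * K)" x0] by simp
  qed (simp add: L)
  then show ?thesis using L(1) by (intro exI[of _ "max L (8 * K)"]) auto
qed

end

section \<open>Stability of optimality under limits\<close>

context separable_metric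
begin

text \<open>The optimality inequality against a fixed competitor \<sigma> passes to the limit,
  because by \<open>W1_tendsto\<close> both weighted costs converge.\<close>

lemma Med_closed_graph:
  assumes v: "\<And>i. i < N \<Longrightarrow> v i \<in> P1" and vs: "\<And>n i. i < N \<Longrightarrow> vs n i \<in> P1"
    and ls: "\<And>i. i < N \<Longrightarrow> (\<lambda>n. ls n i) \<longlonglongrightarrow> l i"
    and conv: "\<And>i. i < N \<Longrightarrow> (\<lambda>n. W1 (vs n i) (v i)) \<longlonglongrightarrow> 0"
    and ms: "\<And>n. ms n \<in> Med N (ls n) (vs n)"
    and \<mu>: "\<mu> \<in> P1" "(\<lambda>n. W1 (ms n) \<mu>) \<longlonglongrightarrow> 0"
  shows "(\<mu> :: 'a measure) \<in> Med N l v"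
  unfolding Med_def
proof (intro CollectI conjI ballI \<mu>(1))
  fix \<sigma> :: "'a measure" assume \<sigma>: "\<sigma> \<in> P1"
  have msP1: "ms n \<in> P1" for n using ms[of n] by (simp add: Med_def)
  have "(\<lambda>n. \<Sum>i<N. ls n i * W1 (vs n i) (ms n)) \<longlonglongrightarrow> (\<Sum>i<N. l i * W1 (v i) \<mu>)"
    using msP1 by (intro tendsto_sum tendsto_mult ls W1_tendsto vs v conv \<mu>) auto
  moreover have "(\<lambda>n. \<Sum>i<N. ls n i * W1 (vs n i) \<sigma>) \<longlonglongrightarrow> (\<Sum>i<N. l i * W1 (v i) \<sigma>)"
    by (intro tendsto_sum tendsto_mult ls W1_tendsto vs v conv \<sigma>) (auto simp: W1_refl \<sigma>)
  ultimately show "(\<Sum>i<N. l i * W1 (v i) \<mu>) \<le> (\<Sum>i<N. l i * W1 (v i) \<sigma>)"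
    by (rule LIMSEQ_le) (use ms \<sigma> in \<open>auto simp: Med_def\<close>)
qed

end

lemma (in proper_metric) Med_convergent_subsequence:
  assumes nu: "\<And>i. i < N \<Longrightarrow> nu i \<in> P1"
    and lams: "\<And>n. unit_simplex N (lams n)" and nus: "\<And>n i. i < N \<Longrightarrow> nus n i \<in> P1"
    and lim: "\<And>i. i < N \<Longrightarrow> (\<lambda>n. lams n i) \<longlonglongrightarrow> lam i"
    and conv: "\<And>i. i < N \<Longrightarrow> (\<lambda>n. W1 (nus n i) (nu i)) \<longlonglongrightarrow> 0"
    and mus: "\<And>n. mus n \<in> Med N (lams n) (nus n)"
  shows "\<exists>r \<mu>. strict_mono (r :: nat \<Rightarrow> nat) \<and> \<mu> \<in> Med N lam nu
    \<and> (\<lambda>k. W1 (mus (r k)) (\<mu> :: 'a measure)) \<longlonglongrightarrow> 0"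
proof -
  have P1: "mus n \<in> P1" for n using mus[of n] by (simp add: Med_def)
  obtain r \<mu> where r: "strict_mono r" and \<mu>: "\<mu> \<in> P1" "(\<lambda>k. W1 (mus (r k)) \<mu>) \<longlonglongrightarrow> 0"
  proof (rule uniformly_integrable_W1_convergent_subsequence[of mus])
    show "\<exists>K\<ge>0. \<forall>n. tail (d 0) K (mus n) < e" if "0 < e" for e
      by (rule Med_uniformly_integrable[OF nu lams nus conv mus that])
  qed (use P1 in auto)
  have "\<mu> \<in> Med N lam nu"
  proof (rule Med_closed_graph[where ls = "\<lambda>k. lams (r k)" and vs = "\<lambda>k. nus (r k)" and ms = "\<lambda>k. mus (r k)"])
    show "(\<lambda>k. lams (r k) i) \<longlonglongrightarrow> lam i" "(\<lambda>k. W1 (nus (r k) i) (nu i)) \<longlonglongrightarrow> 0" if "i < N" for i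
      using LIMSEQ_subseq_LIMSEQ[OF lim[OF that] r] LIMSEQ_subseq_LIMSEQ[OF conv[OF that] r]
      by (simp_all add: comp_def)
  qed (use nu nus mus \<mu> in auto)
  then show ?thesis using r \<mu>(2) by blast
qed

section \<open>Passage from properness to a dense sequence, and conclusion\<close>

lemma proper_space_dense_sequence:
  assumes "proper_space TYPE('a::metric_space)"
  obtains d :: "nat \<Rightarrow> 'a::metric_space" where "proper_metric d"
proof -
  have cpt: "compact (cball x r)" for x :: 'a and r
    using assms by (simp add: proper_space_def)
  define p :: 'a where "p = undefined"
  \<comment> \<open>The balls of integer radius around \<open>p\<close> exhaust the space and are
    compact, hence totally bounded. Their finite nets of mesh 1 / (m + 1) form a countable dense
    set.\<close>
  have "\<exists>F. finite F \<and> cball p (real n) \<subseteq> (\<Union>x\<in>F. ball x (1 / real (Suc m)))" for n m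
    using seq_compact_imp_totally_bounded[OF compact_imp_seq_compact[OF cpt[of p "real n"]],
        rule_format, of "1 / real (Suc m)"] by auto
  then obtain F where F: "\<And>n m. finite (F n m)"
    "\<And>n m. cball p (real n) \<subseteq> (\<Union>x\<in>F n m. ball x (1 / real (Suc m)))" by metis
  define D where "D = insert p (\<Union>n m. F n m)"
  have D: "countable D" "D \<noteq> {}"
    using countable_finite[OF F(1)] by (auto simp: D_def)
  have "proper_metric (from_nat_into D)"
  proof unfold_locales
    fix e :: real and x :: 'a assume "0 < e"
    obtain m where m: "1 / real (Suc m) < e" using nat_approx_posE[OF \<open>0 < e\<close>] .
    obtain n where "dist p x \<le> real n" using real_arch_simple by blast
    then have "x \<in> cball p (real n)" by simp
    then obtain y where y: "y \<in> F n m" "dist y x < 1 / real (Suc m)"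
      using F(2)[of n m] by auto
    then have "y \<in> D" by (auto simp: D_def)
    then obtain k where "from_nat_into D k = y"
      using from_nat_into_surj[OF D(1)] by blast
    then show "\<exists>k. dist (from_nat_into D k) x < e" using y(2) m by (intro exI[of _ k]) simp
  qed (rule cpt)
  then show ?thesis by (rule that)
qed

lemma sum_Max_tendsto_0D:
  fixes w :: "nat \<Rightarrow> nat \<Rightarrow> real"
  assumes lim: "(\<lambda>n. (\<Sum>i<N. \<bar>ls n i - l i\<bar>) + Max (w n ` {..<N})) \<longlonglongrightarrow> 0"
    and w: "\<And>n i. 0 \<le> w n i" and i: "i < N"
  shows "(\<lambda>n. ls n i) \<longlonglongrightarrow> l i" "(\<lambda>n. w n i) \<longlonglongrightarrow> 0"
proof -
  have sum: "\<bar>ls n i - l i\<bar> \<le> (\<Sum>i<N. \<bar>ls n i - l i\<bar>)" for n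
    using i by (intro member_le_sum) auto
  have Max: "w n i \<le> Max (w n ` {..<N})" for n
    using i by (intro Max_ge) auto
  have "(\<lambda>n. ls n i - l i) \<longlonglongrightarrow> 0"
  proof (rule Lim_null_comparison[OF _ lim], intro always_eventually allI)
    fix n
    show "norm (ls n i - l i) \<le> (\<Sum>i<N. \<bar>ls n i - l i\<bar>) + Max (w n ` {..<N})"
      using sum[of n] Max[of n] w[of n i] by simp
  qed
  then show "(\<lambda>n. ls n i) \<longlonglongrightarrow> l i" by (rule LIM_zero_cancel)
  show "(\<lambda>n. w n i) \<longlonglongrightarrow> 0"
  proof (rule Lim_null_comparison[OF _ lim], intro always_eventually allI)
    fix n
    show "norm (w n i) \<le> (\<Sum>i<N. \<bar>ls n i - l i\<bar>) + Max (w n ` {..<N})"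
      using sum[of n] Max[of n] w[of n i] by simp
  qed
qed

theorem theorem3p2:
  fixes N :: nat
    and lam :: "nat \<Rightarrow> real" and nu :: "nat \<Rightarrow> 'a::metric_space measure"
    and lams :: "nat \<Rightarrow> nat \<Rightarrow> real" and nus :: "nat \<Rightarrow> nat \<Rightarrow> 'a measure"
    and mus :: "nat \<Rightarrow> 'a measure"
  assumes proper: "proper_space TYPE('a)"
    and N: "N \<ge> 1"
    and lam: "unit_simplex N lam" and nu: "\<forall>i<N. nu i \<in> P1"
    and lams: "\<forall>n. unit_simplex N (lams n)" and nus: "\<forall>n. \<forall>i<N. nus n i \<in> P1"
    and conv: "(\<lambda>n. (\<Sum>i<N. \<bar>lams n i - lam i\<bar>) + Max ((\<lambda>i. W1 (nus n i) (nu i)) ` {..<N}))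
               \<longlonglongrightarrow> 0"
    and mus: "\<forall>n. mus n \<in> Med N (lams n) (nus n)"
  shows "(\<exists>r \<mu>. strict_mono r \<and> \<mu> \<in> Med N lam nu \<and> (\<lambda>k. W1 (mus (r k)) \<mu>) \<longlonglongrightarrow> 0)
     \<and> (\<forall>m :: nat \<Rightarrow> 'a measure. (\<forall>n. m n \<in> Med N lam nu) \<longrightarrow>
          (\<exists>r \<mu>. strict_mono r \<and> \<mu> \<in> Med N lam nu \<and> (\<lambda>k. W1 (m (r k)) \<mu>) \<longlonglongrightarrow> 0))
     \<and> (\<forall>(l :: nat \<Rightarrow> real) (v :: nat \<Rightarrow> 'a measure) (ls :: nat \<Rightarrow> nat \<Rightarrow> real)
          (vs :: nat \<Rightarrow> nat \<Rightarrow> 'a measure) (ms :: nat \<Rightarrow> 'a measure) (\<mu> :: 'a measure).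
          unit_simplex N l \<and> (\<forall>i<N. v i \<in> P1) \<and> (\<forall>n. unit_simplex N (ls n)) \<and> (\<forall>n. \<forall>i<N. vs n i \<in> P1)
          \<and> (\<lambda>n. (\<Sum>i<N. \<bar>ls n i - l i\<bar>) + Max ((\<lambda>i. W1 (vs n i) (v i)) ` {..<N})) \<longlonglongrightarrow> 0
          \<and> (\<forall>n. ms n \<in> Med N (ls n) (vs n)) \<and> \<mu> \<in> P1 \<and> (\<lambda>n. W1 (ms n) \<mu>) \<longlonglongrightarrow> 0
          \<longrightarrow> \<mu> \<in> Med N l v)"
proof -
  obtain d :: "nat \<Rightarrow> 'a" where "proper_metric d"
    using proper by (rule proper_space_dense_sequence)
  then interpret proper_metric d .
  note limD = sum_Max_tendsto_0D[where w = "\<lambda>n i. W1 (vs n i) (v i)" for vs v, OF _ W1_nonneg]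
  show ?thesis
  proof (intro conjI allI impI)
    show "\<exists>r \<mu>. strict_mono r \<and> \<mu> \<in> Med N lam nu \<and> (\<lambda>k. W1 (mus (r k)) \<mu>) \<longlonglongrightarrow> 0"
      using nu lams nus mus limD[OF conv] by (intro Med_convergent_subsequence[of N nu lams nus]) auto
  next
    fix m :: "nat \<Rightarrow> 'a measure" assume "\<forall>n. m n \<in> Med N lam nu"
    \<comment> \<open>Compactness, in sequential form, is the subsequence statement for constant
      data.\<close>
    then show "\<exists>r \<mu>. strict_mono r \<and> \<mu> \<in> Med N lam nu \<and> (\<lambda>k. W1 (m (r k)) \<mu>) \<longlonglongrightarrow> 0"
      using nu lam
      by (intro Med_convergent_subsequence[where lams = "\<lambda>_. lam" and nus = "\<lambda>_. nu"])
        (auto simp: W1_refl)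
  next
    fix l :: "nat \<Rightarrow> real" and v :: "nat \<Rightarrow> 'a measure" and ls vs
      and ms :: "nat \<Rightarrow> 'a measure" and \<mu> :: "'a measure"
    assume A: "unit_simplex N l \<and> (\<forall>i<N. v i \<in> P1) \<and> (\<forall>n. unit_simplex N (ls n))
      \<and> (\<forall>n. \<forall>i<N. vs n i \<in> P1)
      \<and> (\<lambda>n. (\<Sum>i<N. \<bar>ls n i - l i\<bar>) + Max ((\<lambda>i. W1 (vs n i) (v i)) ` {..<N})) \<longlonglongrightarrow> 0
      \<and> (\<forall>n. ms n \<in> Med N (ls n) (vs n)) \<and> \<mu> \<in> P1 \<and> (\<lambda>n. W1 (ms n) \<mu>) \<longlonglongrightarrow> 0"
    then have "(\<lambda>n. (\<Sum>i<N. \<bar>ls n i - l i\<bar>) + Max ((\<lambda>i. W1 (vs n i) (v i)) ` {..<N})) \<longlonglongrightarrow> 0"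
      by blast
    note lims = limD[OF this]
    from A show "\<mu> \<in> Med N l v"
      by (intro Med_closed_graph[OF _ _ lims]) auto
  qed
qed

end
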